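(* A finitely presented invertible rewriting 2-theory is Mac Lane coherent if it has an orientation whose positive subtheory is terminating and locally commuting-confluent.
   Context: All compositions are written in diagrammatic order ($f\cdot g$ is $f$ followed by $g$). **Rewriting 2-theories.** $X$ is a fixed countably infinite set of variables. For a graded set $\mathcal{F}=\coprod_n\mathcal{F}_n$ of function symbols, $\mathbb{F}_{\mathcal{F}}(X)$ is the absolutely free term algebra. For a set $\mathcal{E}_{\mathcal{F}}$ of equations between terms, $[t]$ is the class of $t$ modulo the equational theory generated by $\mathcal{E}_{\mathcal{F}}$. A labelled rewriting theory $\langle\mathcal{F};\mathcal{T}\mid\mathcal{E}_{\mathcal{F}}\rangle$ also has a set $\mathcal{T}$ of labelled reduction rules $\tau:[s]\to[t]$ (each label has a unique source and target). Reductions are generated inductively by: identities $1_s:[s]\to[s]$; $F(\varphi_1,\dots,\varphi_n):[F(s_1,\dots,s_n)]\to[F(t_1,\dots,t_n)]$ for $F\in\mathcal{F}_n$ and reductions $\varphi_i:[s_i]\to[t_i]$; $\tau(\varphi_1,\dots,\varphi_n):[s(s_1,\dots,s_n)]\to[t(t_1,\dots,t_n)]$ for a rule $\tau:[s(x_1,\dots,x_n)]\to[t(x_1,\dots,x_n)]$ (of rank $n$); and composites $\varphi\cdot\psi$. A rewriting 2-theory $\mathcal{R}=\langle\mathcal{F};\mathcal{T}\mid\mathcal{E}_{\mathcal{F}};\mathcal{E}_{\mathcal{T}}\rangle$ has in addition a set $\mathcal{E}_{\mathcal{T}}$ of equations between reductions with common source and common target, together with the standard congruence: identities are units for $\cdot$;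 $\cdot$ is associative; $F(\varphi_1,\dots,\varphi_n)\cdot F(\psi_1,\dots,\psi_n)=F(\varphi_1\cdot\psi_1,\dots,\varphi_n\cdot\psi_n)$; and for $\varphi:[s]\to[t]$, $\varphi_i:[s_i]\to[t_i]$: $\varphi(\varphi_1,\dots,\varphi_n)=s(\varphi_1,\dots,\varphi_n)\cdot\varphi(1_{t_1},\dots,1_{t_n})=\varphi(1_{s_1},\dots,1_{s_n})\cdot t(\varphi_1,\dots,\varphi_n)$. $\mathbb{F}(\mathcal{R})$ denotes terms (modulo $\mathcal{E}_{\mathcal{F}}$) and reductions, the latter modulo the smallest congruence (closed under function symbols, rules, composition, substitution) generated by $\mathcal{E}_{\mathcal{T}}$ and the standard congruence. $\mathcal{R}$ is finitely presented if $\mathcal{F},\mathcal{T},\mathcal{E}_{\mathcal{F}},\mathcal{E}_{\mathcal{T}}$ are finite. **Mac Lane coherence.** $\mathrm{Shape}$ commutes with composition, function symbols and rules, and sends every other reduction to $\circ$. $\mathrm{Var}(\alpha)$ is the union of the $\mathrm{Var}$'s of the constituents for composites, function symbols and rules, and is $\{\alpha\}$ otherwise. A reduction $\alpha$ is in general position if $|\mathrm{Var}(\alpha)|$ is maximal among the $|\mathrm{Var}(\tau)|$ for reductions $\tau$ with the same shape. $\mathcal{R}$ is Mac Lane coherent if any two parallel reductions in general position in $\mathbb{F}(\mathcal{R})$ are equal. **Invertibility and orientations.** A rule $\varphi:[s]\to[t]$ in $\mathcal{T}$ is invertible if there are a rule $\psi:[t]\to[s]$ in $\mathcal{T}$ (an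 inverse of $\varphi$) and a variable substitution $\sigma:X\to X$ such that the equations $\varphi^\sigma\cdot\psi^\sigma=1_{s^\sigma}$ and $\psi^\sigma\cdot\varphi^\sigma=1_{t^\sigma}$ are in $\mathcal{E}_{\mathcal{T}}$. $\mathcal{R}$ is invertible if all its rules are. An orientation of $\mathcal{R}$ is a function $\mathcal{O}:\mathcal{T}\to\{1,-1\}$ with $\mathcal{O}(\alpha)=1$ for every non-invertible rule $\alpha$ and, for every invertible pair of rules $(\alpha,\beta)$, $\{\mathcal{O}(\alpha),\mathcal{O}(\beta)\}=\{1,-1\}$. Rules with $\mathcal{O}(\alpha)=1$ are positive, the others negative. The positive subtheory relative to $\mathcal{O}$ arises from $\mathcal{R}$ by discarding all negative rules from $\mathcal{T}$ and all equations of $\mathcal{E}_{\mathcal{T}}$ that contain an instance of a negative rule. **Termination and confluence.** Singular reductions are those $\rho(1_{t_1},\dots,1_{t_n})$ with $\rho\in\mathcal{T}$ of rank $n$, and, inductively, $F(1,\dots,1,\rho,1,\dots,1)$ with $F\in\mathcal{F}$ and $\rho$ singular. A rewriting 2-theory $\mathcal{R}$ is terminating if any infinite sequence of composable singular reductions in $\mathbb{F}(\mathcal{R})$ contains cofinitely many identity reductions. A span in $\mathbb{F}(\mathcal{R})$ is a pair of reductions $u_1\xleftarrow{\varphi_1}s\xrightarrow{\varphi_2}u_2$; it is singular if $\varphi_1,\varphi_2$ are singular; it is commuting-joinable if there are a term $t$ and reductions $\psi_i:u_i\to t$ with $\varphi_1\cdot\psi_1=\varphi_2\cdot\psi_2$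 in $\mathbb{F}(\mathcal{R})$. $\mathcal{R}$ is locally commuting-confluent if every singular span in $\mathbb{F}(\mathcal{R})$ is commuting-joinable.
   Formalization: In the definition of an invertible rule, the variable substitution σ: X→X is required to be injective (a renaming); with variable-identifying substitutions allowed the claim is false. *)

theory Defs
  imports Main
begin

text \<open>Variables are natural numbers: a fixed countably infinite set.\<close>

datatype ('f, vars: 'v) trm = Var 'v | Fn 'f "('f, 'v) trm list"

type_synonym 'f tm = "('f, nat) trm"

fun tsubst :: "(nat \<Rightarrow> 'f tm) \<Rightarrow> 'f tm \<Rightarrow> 'f tm" where
  "tsubst \<sigma> (Var x) = \<sigma> x"
| "tsubst \<sigma> (Fn f ts) = Fn f (map (tsubst \<sigma>) ts)"

text \<open>
  Reduction expressions. Objects are classes of terms modulo the term equations, so an identity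
  carries the class (as a set of terms) on which it sits.
  \<open>Comp \<phi> \<psi>\<close> is diagrammatic: \<open>\<phi>\<close> followed by \<open>\<psi>\<close>.
\<close>

datatype ('f, rule_labels: 'l) red =
    Id "'f tm set"
  | FunR 'f "('f, 'l) red list"
  | RuleR 'l "('f, 'l) red list"
  | Comp "('f, 'l) red" "('f, 'l) red"

text \<open>
  A rule with label \<open>\<tau>\<close> is \<open>\<tau> : [s(x\<^sub>1,\<dots>,x\<^sub>n)] \<rightarrow> [t(x\<^sub>1,\<dots>,x\<^sub>n)]\<close>, where \<open>rvars R \<tau>\<close> lists
  \<open>x\<^sub>1,\<dots>,x\<^sub>n\<close> and \<open>lhs R \<tau>\<close>, \<open>rhs R \<tau>\<close> are representatives \<open>s\<close>, \<open>t\<close> of its source and target.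
\<close>

record ('f, 'l) rw2 =
  syms :: "'f set"
  arity :: "'f \<Rightarrow> nat"
  labels :: "'l set"
  rvars :: "'l \<Rightarrow> nat list"
  lhs :: "'l \<Rightarrow> 'f tm"
  rhs :: "'l \<Rightarrow> 'f tm"
  term_eqs :: "('f tm \<times> 'f tm) set"
  red_eqs :: "(('f, 'l) red \<times> ('f, 'l) red) set"

fun wf_tm :: "('f, 'l) rw2 \<Rightarrow> 'f tm \<Rightarrow> bool" where
  "wf_tm R (Var x) \<longleftrightarrow> True"
| "wf_tm R (Fn f ts) \<longleftrightarrow> f \<in> syms R \<and> length ts = arity R f \<and> (\<forall>t\<in>set ts. wf_tm R t)"

inductive teq :: "('f, 'l) rw2 \<Rightarrow> 'f tm \<Rightarrow> 'f tm \<Rightarrow> bool" for R where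
  teq_refl: "wf_tm R t \<Longrightarrow> teq R t t"
| teq_sym: "teq R s t \<Longrightarrow> teq R t s"
| teq_trans: "teq R s t \<Longrightarrow> teq R t u \<Longrightarrow> teq R s u"
| teq_cong: "f \<in> syms R \<Longrightarrow> length ss = arity R f \<Longrightarrow> list_all2 (teq R) ss ts
    \<Longrightarrow> teq R (Fn f ss) (Fn f ts)"
| teq_ax: "(s, t) \<in> term_eqs R \<Longrightarrow> (\<And>x. wf_tm R (\<sigma> x))
    \<Longrightarrow> teq R (tsubst \<sigma> s) (tsubst \<sigma> t)"

definition cls :: "('f, 'l) rw2 \<Rightarrow> 'f tm \<Rightarrow> 'f tm set" where
  "cls R t = {u. teq R t u}"

definition csubst :: "('f, 'l) rw2 \<Rightarrow> (nat \<Rightarrow> 'f tm) \<Rightarrow> 'f tm set \<Rightarrow> 'f tm set" where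
  "csubst R \<sigma> C = (\<Union>t\<in>C. cls R (tsubst \<sigma> t))"

definition id_on_tm :: "('f, 'l) rw2 \<Rightarrow> 'f tm \<Rightarrow> ('f, 'l) red" where
  "id_on_tm R t = Id (cls R t)"

text \<open>The assignment \<open>x\<^sub>i \<mapsto> y\<^sub>i\<close>, equal to \<open>d\<close> elsewhere.\<close>

definition bind :: "(nat \<Rightarrow> 'a) \<Rightarrow> nat list \<Rightarrow> 'a list \<Rightarrow> nat \<Rightarrow> 'a" where
  "bind d xs ys = (\<lambda>x. case map_of (zip xs ys) x of None \<Rightarrow> d x | Some y \<Rightarrow> y)"

text \<open>\<open>s(s\<^sub>1,\<dots>,s\<^sub>n)\<close>\<close>

definition tapp :: "nat list \<Rightarrow> 'f tm \<Rightarrow> 'f tm list \<Rightarrow> 'f tm" where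
  "tapp xs s ss = tsubst (bind Var xs ss) s"

text \<open>\<open>reduction R \<phi> A B\<close>: \<open>\<phi>\<close> is a reduction from the class \<open>A\<close> to the class \<open>B\<close>.\<close>

inductive reduction ::
  "('f, 'l) rw2 \<Rightarrow> ('f, 'l) red \<Rightarrow> 'f tm set \<Rightarrow> 'f tm set \<Rightarrow> bool" for R where
  red_id: "wf_tm R s \<Longrightarrow> reduction R (Id (cls R s)) (cls R s) (cls R s)"
| red_fun: "f \<in> syms R \<Longrightarrow> length \<phi>s = arity R f \<Longrightarrow> length ss = arity R f \<Longrightarrow> length ts = arity R f
    \<Longrightarrow> (\<forall>i < arity R f. reduction R (\<phi>s ! i) (cls R (ss ! i)) (cls R (ts ! i)))
    \<Longrightarrow> reduction R (FunR f \<phi>s) (cls R (Fn f ss)) (cls R (Fn f ts))"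
| red_rule: "\<tau> \<in> labels R \<Longrightarrow> length \<phi>s = length (rvars R \<tau>)
    \<Longrightarrow> length ss = length (rvars R \<tau>) \<Longrightarrow> length ts = length (rvars R \<tau>)
    \<Longrightarrow> (\<forall>i < length (rvars R \<tau>). reduction R (\<phi>s ! i) (cls R (ss ! i)) (cls R (ts ! i)))
    \<Longrightarrow> reduction R (RuleR \<tau> \<phi>s)
          (cls R (tapp (rvars R \<tau>) (lhs R \<tau>) ss)) (cls R (tapp (rvars R \<tau>) (rhs R \<tau>) ts))"
| red_comp: "reduction R \<phi> A B \<Longrightarrow> reduction R \<psi> B C \<Longrightarrow> reduction R (Comp \<phi> \<psi>) A C"

text \<open>\<open>\<phi>\<^sup>\<sigma>\<close> for a substitution of terms, i.e. \<open>\<phi>(1\<^bsub>\<sigma> x\<^sub>1\<^esub>,\<dots>,1\<^bsub>\<sigma> x\<^sub>n\<^esub>)\<close>\<close>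

fun rsubst :: "('f, 'l) rw2 \<Rightarrow> (nat \<Rightarrow> 'f tm) \<Rightarrow> ('f, 'l) red \<Rightarrow> ('f, 'l) red" where
  "rsubst R \<sigma> (Id C) = Id (csubst R \<sigma> C)"
| "rsubst R \<sigma> (FunR f \<phi>s) = FunR f (map (rsubst R \<sigma>) \<phi>s)"
| "rsubst R \<sigma> (RuleR \<tau> \<phi>s) = RuleR \<tau> (map (rsubst R \<sigma>) \<phi>s)"
| "rsubst R \<sigma> (Comp \<phi> \<psi>) = Comp (rsubst R \<sigma> \<phi>) (rsubst R \<sigma> \<psi>)"

text \<open>\<open>s(\<phi>\<^sub>1,\<dots>,\<phi>\<^sub>n)\<close> for a term \<open>s\<close>, where \<open>\<theta> x\<^sub>i = \<phi>\<^sub>i\<close>\<close>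

fun tred :: "(nat \<Rightarrow> ('f, 'l) red) \<Rightarrow> 'f tm \<Rightarrow> ('f, 'l) red" where
  "tred \<theta> (Var x) = \<theta> x"
| "tred \<theta> (Fn f ts) = FunR f (map (tred \<theta>) ts)"

definition tred_app :: "('f, 'l) rw2 \<Rightarrow> nat list \<Rightarrow> 'f tm \<Rightarrow> ('f, 'l) red list \<Rightarrow> ('f, 'l) red" where
  "tred_app R xs s \<phi>s = tred (bind (\<lambda>x. id_on_tm R (Var x)) xs \<phi>s) s"

definition rule_at :: "('f, 'l) rw2 \<Rightarrow> 'l \<Rightarrow> 'f tm list \<Rightarrow> ('f, 'l) red" where
  "rule_at R \<tau> ts = RuleR \<tau> (map (id_on_tm R) ts)"

text \<open>
  Equality of reductions in \<open>\<bbbF>(R)\<close>. The exchange law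
  \<open>\<phi>(\<phi>\<^sub>1,\<dots>,\<phi>\<^sub>n) = s(\<phi>\<^sub>1,\<dots>,\<phi>\<^sub>n) \<cdot> \<phi>(1,\<dots>,1) = \<phi>(1,\<dots>,1) \<cdot> t(\<phi>\<^sub>1,\<dots>,\<phi>\<^sub>n)\<close> is
  split as follows. For \<open>\<phi>\<close> a rule, all three members are expressions: \<open>req_rule_src\<close> and
  \<open>req_rule_tgt\<close>. For arbitrary \<open>\<phi> : [s] \<rightarrow> [t]\<close> (with arbitrary representatives \<open>s\<close>, \<open>t\<close>), the
  expression grammar has no form \<open>\<phi>(\<phi>\<^sub>1,\<dots>,\<phi>\<^sub>n)\<close>, and the law says that the two composites
  agree: \<open>req_exchange\<close>. If all \<open>\<phi>\<^sub>i\<close> are identities, \<open>\<phi>(\<phi>\<^sub>1,\<dots>,\<phi>\<^sub>n)\<close> is the instance of \<open>\<phi>\<close>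
  under a substitution of terms; the case \<open>\<phi> = 1\<close> on \<open>F(x\<^sub>1,\<dots>,x\<^sub>n)\<close> of the law then reads
  \<open>1 = F(1,\<dots>,1) \<cdot> 1\<close>: \<open>req_fun_id\<close>.
\<close>

inductive req :: "('f, 'l) rw2 \<Rightarrow> ('f, 'l) red \<Rightarrow> ('f, 'l) red \<Rightarrow> bool" for R where
  req_refl: "reduction R \<alpha> A B \<Longrightarrow> req R \<alpha> \<alpha>"
| req_sym: "req R \<alpha> \<beta> \<Longrightarrow> req R \<beta> \<alpha>"
| req_trans: "req R \<alpha> \<beta> \<Longrightarrow> req R \<beta> \<gamma> \<Longrightarrow> req R \<alpha> \<gamma>"
| req_ax: "(\<alpha>, \<beta>) \<in> red_eqs R \<Longrightarrow> req R \<alpha> \<beta>"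
| req_fun: "f \<in> syms R \<Longrightarrow> length \<alpha>s = arity R f \<Longrightarrow> list_all2 (req R) \<alpha>s \<beta>s
    \<Longrightarrow> req R (FunR f \<alpha>s) (FunR f \<beta>s)"
| req_rule: "\<tau> \<in> labels R \<Longrightarrow> length \<alpha>s = length (rvars R \<tau>) \<Longrightarrow> list_all2 (req R) \<alpha>s \<beta>s
    \<Longrightarrow> req R (RuleR \<tau> \<alpha>s) (RuleR \<tau> \<beta>s)"
| req_comp: "req R \<alpha> \<alpha>' \<Longrightarrow> req R \<beta> \<beta>' \<Longrightarrow> reduction R (Comp \<alpha> \<beta>) A C
    \<Longrightarrow> req R (Comp \<alpha> \<beta>) (Comp \<alpha>' \<beta>')"
| req_subst: "req R \<alpha> \<beta> \<Longrightarrow> (\<And>x. wf_tm R (\<sigma> x)) \<Longrightarrow> req R (rsubst R \<sigma> \<alpha>) (rsubst R \<sigma> \<beta>)"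
| req_unit_left: "reduction R \<alpha> A B \<Longrightarrow> req R (Comp (Id A) \<alpha>) \<alpha>"
| req_unit_right: "reduction R \<alpha> A B \<Longrightarrow> req R (Comp \<alpha> (Id B)) \<alpha>"
| req_assoc: "reduction R \<alpha> A B \<Longrightarrow> reduction R \<beta> B C \<Longrightarrow> reduction R \<gamma> C D
    \<Longrightarrow> req R (Comp (Comp \<alpha> \<beta>) \<gamma>) (Comp \<alpha> (Comp \<beta> \<gamma>))"
| req_functor: "f \<in> syms R \<Longrightarrow> length \<phi>s = arity R f \<Longrightarrow> length \<psi>s = arity R f
    \<Longrightarrow> (\<forall>i < arity R f. \<exists>A B C. reduction R (\<phi>s ! i) A B \<and> reduction R (\<psi>s ! i) B C)
    \<Longrightarrow> req R (Comp (FunR f \<phi>s) (FunR f \<psi>s)) (FunR f (map2 Comp \<phi>s \<psi>s))"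
| req_fun_id: "wf_tm R (Fn f ts) \<Longrightarrow> req R (FunR f (map (id_on_tm R) ts)) (id_on_tm R (Fn f ts))"
| req_rule_src: "\<tau> \<in> labels R \<Longrightarrow> length \<phi>s = length (rvars R \<tau>)
    \<Longrightarrow> length ss = length (rvars R \<tau>) \<Longrightarrow> length ts = length (rvars R \<tau>)
    \<Longrightarrow> (\<forall>i < length (rvars R \<tau>). reduction R (\<phi>s ! i) (cls R (ss ! i)) (cls R (ts ! i)))
    \<Longrightarrow> req R (RuleR \<tau> \<phi>s) (Comp (tred_app R (rvars R \<tau>) (lhs R \<tau>) \<phi>s) (rule_at R \<tau> ts))"
| req_rule_tgt: "\<tau> \<in> labels R \<Longrightarrow> length \<phi>s = length (rvars R \<tau>)
    \<Longrightarrow> length ss = length (rvars R \<tau>) \<Longrightarrow> length ts = length (rvars R \<tau>)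
    \<Longrightarrow> (\<forall>i < length (rvars R \<tau>). reduction R (\<phi>s ! i) (cls R (ss ! i)) (cls R (ts ! i)))
    \<Longrightarrow> req R (RuleR \<tau> \<phi>s) (Comp (rule_at R \<tau> ss) (tred_app R (rvars R \<tau>) (rhs R \<tau>) \<phi>s))"
| req_exchange: "reduction R \<phi> (cls R s) (cls R t)
    \<Longrightarrow> (\<And>x. reduction R (\<theta> x) (cls R (\<sigma> x)) (cls R (\<rho> x)))
    \<Longrightarrow> req R (Comp (tred \<theta> s) (rsubst R \<rho> \<phi>)) (Comp (rsubst R \<sigma> \<phi>) (tred \<theta> t))"

definition rewriting_2_theory :: "('f, 'l) rw2 \<Rightarrow> bool" where
  "rewriting_2_theory R \<longleftrightarrow>
     (\<forall>(s, t) \<in> term_eqs R. wf_tm R s \<and> wf_tm R t) \<and>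
     (\<forall>\<tau> \<in> labels R. distinct (rvars R \<tau>) \<and> wf_tm R (lhs R \<tau>) \<and> wf_tm R (rhs R \<tau>) \<and>
        vars (lhs R \<tau>) \<union> vars (rhs R \<tau>) \<subseteq> set (rvars R \<tau>)) \<and>
     (\<forall>(\<alpha>, \<beta>) \<in> red_eqs R. \<exists>A B. reduction R \<alpha> A B \<and> reduction R \<beta> A B)"

definition finitely_presented :: "('f, 'l) rw2 \<Rightarrow> bool" where
  "finitely_presented R \<longleftrightarrow>
     finite (syms R) \<and> finite (labels R) \<and> finite (term_eqs R) \<and> finite (red_eqs R)"

datatype ('f, 'l) shape =
    Hole
  | FunS 'f "('f, 'l) shape list"
  | RuleS 'l "('f, 'l) shape list"
  | CompS "('f, 'l) shape" "('f, 'l) shape"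

fun shape_of :: "('f, 'l) red \<Rightarrow> ('f, 'l) shape" where
  "shape_of (Id C) = Hole"
| "shape_of (FunR f \<phi>s) = FunS f (map shape_of \<phi>s)"
| "shape_of (RuleR \<tau> \<phi>s) = RuleS \<tau> (map shape_of \<phi>s)"
| "shape_of (Comp \<phi> \<psi>) = CompS (shape_of \<phi>) (shape_of \<psi>)"

fun red_vars :: "('f, 'l) red \<Rightarrow> ('f, 'l) red set" where
  "red_vars (Id C) = {Id C}"
| "red_vars (FunR f \<phi>s) = \<Union> (set (map red_vars \<phi>s))"
| "red_vars (RuleR \<tau> \<phi>s) = \<Union> (set (map red_vars \<phi>s))"
| "red_vars (Comp \<phi> \<psi>) = red_vars \<phi> \<union> red_vars \<psi>"

definition general_position :: "('f, 'l) rw2 \<Rightarrow> ('f, 'l) red \<Rightarrow> bool" where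
  "general_position R \<alpha> \<longleftrightarrow> (\<exists>A B. reduction R \<alpha> A B) \<and>
     (\<forall>\<beta> A B. reduction R \<beta> A B \<and> shape_of \<beta> = shape_of \<alpha>
        \<longrightarrow> card (red_vars \<beta>) \<le> card (red_vars \<alpha>))"

definition mac_lane_coherent :: "('f, 'l) rw2 \<Rightarrow> bool" where
  "mac_lane_coherent R \<longleftrightarrow>
     (\<forall>\<alpha> \<beta> A B. reduction R \<alpha> A B \<and> reduction R \<beta> A B \<and>
        general_position R \<alpha> \<and> general_position R \<beta> \<longrightarrow> req R \<alpha> \<beta>)"

definition has_red_eq :: "('f, 'l) rw2 \<Rightarrow> ('f, 'l) red \<Rightarrow> ('f, 'l) red \<Rightarrow> bool" where
  "has_red_eq R \<alpha> \<beta> \<longleftrightarrow> (\<alpha>, \<beta>) \<in> red_eqs R \<or> (\<beta>, \<alpha>) \<in> red_eqs R"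

text \<open>
  The substitution of variables is a renaming. If it could identify variables, the two equations
  would only make special instances of a rule invertible: with rules
  \<open>\<phi> : F(x,y) \<rightarrow> G(x,y)\<close>, \<open>\<psi> : G(x,y) \<rightarrow> F(x,y)\<close> and the equations
  \<open>\<phi>(1\<^sub>x,1\<^sub>x) \<cdot> \<psi>(1\<^sub>x,1\<^sub>x) = 1\<close>, \<open>\<psi>(1\<^sub>x,1\<^sub>x) \<cdot> \<phi>(1\<^sub>x,1\<^sub>x) = 1\<close>, the reduction
  \<open>\<phi>(1\<^sub>x,1\<^sub>y) \<cdot> \<psi>(1\<^sub>x,1\<^sub>y)\<close> is not an identity.
\<close>

definition inverse_rules :: "('f, 'l) rw2 \<Rightarrow> 'l \<Rightarrow> 'l \<Rightarrow> bool" where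
  "inverse_rules R \<phi> \<psi> \<longleftrightarrow> \<phi> \<in> labels R \<and> \<psi> \<in> labels R \<and>
     cls R (lhs R \<psi>) = cls R (rhs R \<phi>) \<and> cls R (rhs R \<psi>) = cls R (lhs R \<phi>) \<and>
     (\<exists>\<sigma> :: nat \<Rightarrow> nat. inj \<sigma> \<and>
        (let \<phi>\<sigma> = rule_at R \<phi> (map (\<lambda>x. Var (\<sigma> x)) (rvars R \<phi>));
             \<psi>\<sigma> = rule_at R \<psi> (map (\<lambda>x. Var (\<sigma> x)) (rvars R \<psi>))
         in has_red_eq R (Comp \<phi>\<sigma> \<psi>\<sigma>) (id_on_tm R (tsubst (\<lambda>x. Var (\<sigma> x)) (lhs R \<phi>))) \<and>
            has_red_eq R (Comp \<psi>\<sigma> \<phi>\<sigma>) (id_on_tm R (tsubst (\<lambda>x. Var (\<sigma> x)) (rhs R \<phi>)))))"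

definition invertible_rule :: "('f, 'l) rw2 \<Rightarrow> 'l \<Rightarrow> bool" where
  "invertible_rule R \<phi> \<longleftrightarrow> (\<exists>\<psi>. inverse_rules R \<phi> \<psi>)"

definition invertible_theory :: "('f, 'l) rw2 \<Rightarrow> bool" where
  "invertible_theory R \<longleftrightarrow> (\<forall>\<tau> \<in> labels R. invertible_rule R \<tau>)"

definition orientation :: "('f, 'l) rw2 \<Rightarrow> ('l \<Rightarrow> int) \<Rightarrow> bool" where
  "orientation R orn \<longleftrightarrow>
     (\<forall>\<alpha> \<in> labels R. orn \<alpha> \<in> {1, -1}) \<and>
     (\<forall>\<alpha> \<in> labels R. \<not> invertible_rule R \<alpha> \<longrightarrow> orn \<alpha> = 1) \<and>
     (\<forall>\<alpha> \<beta>. inverse_rules R \<alpha> \<beta> \<longrightarrow> {orn \<alpha>, orn \<beta>} = {1, -1})"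

definition negative_rules :: "('f, 'l) rw2 \<Rightarrow> ('l \<Rightarrow> int) \<Rightarrow> 'l set" where
  "negative_rules R orn = {\<tau> \<in> labels R. orn \<tau> \<noteq> 1}"

definition positive_subtheory :: "('f, 'l) rw2 \<Rightarrow> ('l \<Rightarrow> int) \<Rightarrow> ('f, 'l) rw2" where
  "positive_subtheory R orn = R
     \<lparr> labels := labels R - negative_rules R orn,
       red_eqs := {(\<alpha>, \<beta>) \<in> red_eqs R.
                     (rule_labels \<alpha> \<union> rule_labels \<beta>) \<inter> negative_rules R orn = {}} \<rparr>"

inductive singular :: "('f, 'l) rw2 \<Rightarrow> ('f, 'l) red \<Rightarrow> bool" for R where
  sing_rule: "\<tau> \<in> labels R \<Longrightarrow> length ts = length (rvars R \<tau>) \<Longrightarrow> (\<forall>t \<in> set ts. wf_tm R t)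
    \<Longrightarrow> singular R (rule_at R \<tau> ts)"
| sing_fun: "f \<in> syms R \<Longrightarrow> length ss + 1 + length ts = arity R f
    \<Longrightarrow> (\<forall>t \<in> set ss \<union> set ts. wf_tm R t) \<Longrightarrow> singular R \<rho>
    \<Longrightarrow> singular R (FunR f (map (id_on_tm R) ss @ \<rho> # map (id_on_tm R) ts))"

definition terminating :: "('f, 'l) rw2 \<Rightarrow> bool" where
  "terminating R \<longleftrightarrow>
     (\<forall>\<phi> :: nat \<Rightarrow> ('f, 'l) red. \<forall>A :: nat \<Rightarrow> 'f tm set.
        (\<forall>i. singular R (\<phi> i) \<and> reduction R (\<phi> i) (A i) (A (Suc i)))
        \<longrightarrow> finite {i. \<not> req R (\<phi> i) (Id (A i))})"

definition commuting_joinable ::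
  "('f, 'l) rw2 \<Rightarrow> ('f, 'l) red \<Rightarrow> ('f, 'l) red \<Rightarrow> bool" where
  "commuting_joinable R \<phi>\<^sub>1 \<phi>\<^sub>2 \<longleftrightarrow>
     (\<exists>S U\<^sub>1 U\<^sub>2 T \<psi>\<^sub>1 \<psi>\<^sub>2. reduction R \<phi>\<^sub>1 S U\<^sub>1 \<and> reduction R \<phi>\<^sub>2 S U\<^sub>2 \<and>
        reduction R \<psi>\<^sub>1 U\<^sub>1 T \<and> reduction R \<psi>\<^sub>2 U\<^sub>2 T \<and> req R (Comp \<phi>\<^sub>1 \<psi>\<^sub>1) (Comp \<phi>\<^sub>2 \<psi>\<^sub>2))"

definition locally_commuting_confluent :: "('f, 'l) rw2 \<Rightarrow> bool" where
  "locally_commuting_confluent R \<longleftrightarrow>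
     (\<forall>\<phi>\<^sub>1 \<phi>\<^sub>2 S U\<^sub>1 U\<^sub>2. singular R \<phi>\<^sub>1 \<and> singular R \<phi>\<^sub>2 \<and>
        reduction R \<phi>\<^sub>1 S U\<^sub>1 \<and> reduction R \<phi>\<^sub>2 S U\<^sub>2 \<longrightarrow> commuting_joinable R \<phi>\<^sub>1 \<phi>\<^sub>2)"

end

theory Submission
  imports Defs
begin

text \<open>
  By Newman's argument, carried out with commuting diagrams, any two positive reductions from an
  object to a normal form are equal. Every reduction is a composite of singular ones, and every
  negative singular reduction is inverse to a positive one, so the reductions \<open>\<nu>\<^sub>A : A \<rightarrow> N\<close> to normal
  form satisfy \<open>\<nu>\<^sub>A = \<alpha> \<cdot> \<nu>\<^sub>B\<close> for all \<open>\<alpha> : A \<rightarrow> B\<close>, positive or not. As \<open>\<nu>\<^sub>B\<close> is invertible,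
  \<open>\<alpha> = \<nu>\<^sub>A \<cdot> \<nu>\<^sub>B\<^sup>-\<^sup>1\<close> depends only on \<open>A\<close> and \<open>B\<close>.
\<close>

text \<open>Newman's argument yields equality in the positive subtheory, whose congruence has fewer
  generators. It is transported along the inclusion into \<open>R\<close>, and the inverse of
  \<open>\<nu>\<^sub>B\<close> is built there, because the inverses of positive rules are negative.
  Termination and local confluence speak only of singular reductions, whereas an expression may
  apply a symbol or a rule to many reductions at once; functoriality of symbols and the exchange law
  for rules have to serialize expressions before any induction can start. A second source of work is
  that objects are classes of terms: typing derivations choose representatives freely, so uniqueness
  of endpoints has to be established before composites can be matched.\<close>

section \<open>Bindings, term substitution and term classes\<close>

lemma bind_nth:
  assumes "distinct xs" "length ys = length xs" "i < length xs"
  shows "bind d xs ys (xs ! i) = ys ! i"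
  using assms by (simp add: bind_def map_of_zip_nth)

lemma bind_notin: "length ys = length xs \<Longrightarrow> x \<notin> set xs \<Longrightarrow> bind d xs ys x = d x"
  by (simp add: bind_def map_of_zip_is_None[THEN iffD2])

lemma bind_cases:
  assumes "distinct xs" "length ys = length xs"
  obtains i where "i < length xs" "x = xs ! i" "bind d xs ys x = ys ! i"
    | "x \<notin> set xs" "bind d xs ys x = d x"
  using assms bind_nth bind_notin by (metis in_set_conv_nth)

text \<open>The two defaults may differ because a bound \<open>x\<close> never reaches them.\<close>

lemma bind_map:
  assumes "length ys = length xs" "x \<in> set xs"
  shows "bind d' xs (map h ys) x = h (bind d xs ys x)"
proof -
  obtain y where "map_of (zip xs ys) x = Some y"
    using assms by (metis map_of_eq_None_iff map_fst_zip not_None_eq list.set_map)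
  moreover have "map_of (zip xs (map h ys)) x = map_option h (map_of (zip xs ys) x)"
    by (simp add: zip_map2 map_of_map)
  ultimately show ?thesis
    by (simp add: bind_def)
qed

lemma tsubst_cong: "(\<And>x. x \<in> vars s \<Longrightarrow> \<sigma> x = \<rho> x) \<Longrightarrow> tsubst \<sigma> s = tsubst \<rho> s"
  by (induction s) auto

lemma tsubst_tsubst: "tsubst \<sigma> (tsubst \<rho> s) = tsubst (\<lambda>x. tsubst \<sigma> (\<rho> x)) s"
  by (induction s) auto

text \<open>A variable of \<open>s\<close> outside \<open>xs\<close> would become
  \<open>\<sigma> x\<close> on the left and stay itself on the right, hence the condition on
  \<open>vars s\<close>.\<close>

lemma tsubst_tapp:
  assumes "length ss = length xs" "vars s \<subseteq> set xs"
  shows "tsubst \<sigma> (tapp xs s ss) = tapp xs s (map (tsubst \<sigma>) ss)"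
  unfolding tapp_def tsubst_tsubst
  by (intro tsubst_cong) (use assms in \<open>auto intro!: bind_map[symmetric]\<close>)

lemma wf_tsubst: "wf_tm R s \<Longrightarrow> (\<And>x. wf_tm R (\<sigma> x)) \<Longrightarrow> wf_tm R (tsubst \<sigma> s)"
  by (induction s) auto

lemma wf_bind:
  assumes "distinct xs" "length ys = length xs" "\<And>t. t \<in> set ys \<Longrightarrow> wf_tm R t"
  shows "wf_tm R (bind Var xs ys x)"
  using assms(1,2) by (cases rule: bind_cases[where x = x and d = Var]) (use assms in auto)

lemma tsubst_teq:
  assumes "wf_tm R s" "\<And>x. teq R (\<sigma> x) (\<rho> x)"
  shows "teq R (tsubst \<sigma> s) (tsubst \<rho> s)"
  using assms(1)
proof (induction s)
  case (Fn f ts)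
  then show ?case
    by (auto intro!: teq_cong simp: list_all2_conv_all_nth)
qed (use assms in auto)

lemma same_cls: "teq R s t \<Longrightarrow> cls R s = cls R t"
  unfolding cls_def by (blast intro: teq_sym teq_trans)

lemma cls_eqD: "cls R s = cls R t \<Longrightarrow> wf_tm R t \<Longrightarrow> teq R s t"
  unfolding cls_def by (blast intro: teq_refl)

lemmas [trans] = req_trans

section \<open>Typing of reductions and uniqueness of endpoints\<close>

locale rewriting_2 =
  fixes R :: "('f, 'l) rw2"
  assumes theory_R: "rewriting_2_theory R"
begin

lemma rule_wf:
  assumes "\<tau> \<in> labels R"
  shows "distinct (rvars R \<tau>)" "wf_tm R (lhs R \<tau>)" "wf_tm R (rhs R \<tau>)"
    "vars (lhs R \<tau>) \<subseteq> set (rvars R \<tau>)" "vars (rhs R \<tau>) \<subseteq> set (rvars R \<tau>)"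
  using theory_R assms unfolding rewriting_2_theory_def by auto

lemma teq_wf: "teq R s t \<Longrightarrow> wf_tm R s \<and> wf_tm R t"
proof (induction rule: teq.induct)
  case (teq_ax s t \<sigma>)
  then have "wf_tm R s \<and> wf_tm R t"
    using theory_R unfolding rewriting_2_theory_def by auto
  with teq_ax show ?case
    by (simp add: wf_tsubst)
qed (auto simp: list_all2_conv_all_nth in_set_conv_nth)

text \<open>An ill-formed term has an empty class, because \<open>teq\<close> relates only
  well-formed terms.\<close>

lemma cls_wf: "wf_tm R s \<Longrightarrow> cls R t = cls R s \<Longrightarrow> wf_tm R t"
  using cls_eqD teq_wf by blast

lemma teq_tsubst:
  assumes "teq R s t" "\<And>x. wf_tm R (\<sigma> x)"
  shows "teq R (tsubst \<sigma> s) (tsubst \<sigma> t)"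
  using assms(1)
proof (induction rule: teq.induct)
  case (teq_ax s t \<rho>)
  then show ?case
    by (auto simp: tsubst_tsubst intro!: teq.teq_ax wf_tsubst assms)
next
  case (teq_trans s t u)
  then show ?case by (blast intro: teq.teq_trans)
next
  case (teq_sym s t)
  then show ?case by (blast intro: teq.teq_sym)
qed (auto intro!: teq_refl wf_tsubst assms teq_cong simp: list_all2_conv_all_nth)

text \<open>The union in \<open>csubst\<close> runs over all representatives, but substitution
  respects \<open>teq\<close>, so all its members are one and the same class.\<close>

lemma csubst_cls:
  assumes "wf_tm R s" "\<And>x. wf_tm R (\<sigma> x)"
  shows "csubst R \<sigma> (cls R s) = cls R (tsubst \<sigma> s)"
proof -
  have "cls R (tsubst \<sigma> t) = cls R (tsubst \<sigma> s)" if "t \<in> cls R s" for t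
  proof -
    have "teq R s t"
      using that by (simp add: cls_def)
    then show ?thesis
      by (intro same_cls teq_sym[OF teq_tsubst] assms)
  qed
  moreover have "s \<in> cls R s"
    using teq_refl[OF assms(1)] by (simp add: cls_def)
  ultimately show ?thesis
    unfolding csubst_def by fast
qed

lemma cls_tapp_cong:
  assumes "distinct xs" "wf_tm R l" "length ss = length xs" "length ts = length xs"
    and "\<And>i. i < length xs \<Longrightarrow> wf_tm R (ts ! i) \<and> cls R (ss ! i) = cls R (ts ! i)"
  shows "cls R (tapp xs l ss) = cls R (tapp xs l ts)"
  unfolding tapp_def
proof (intro same_cls tsubst_teq assms)
  fix x
  show "teq R (bind Var xs ss x) (bind Var xs ts x)"
  proof (cases "x \<in> set xs")
    case True
    then show ?thesis
      using assms bind_nth cls_eqD by (metis in_set_conv_nth)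
  qed (use assms in \<open>auto simp: bind_notin intro: teq_refl\<close>)
qed

lemma cls_Fn_cong:
  assumes "wf_tm R (Fn f ts)" "length ss = length ts"
    and "\<And>i. i < length ts \<Longrightarrow> cls R (ss ! i) = cls R (ts ! i)"
  shows "cls R (Fn f ss) = cls R (Fn f ts)"
  using assms by (intro same_cls teq_cong) (auto simp: list_all2_conv_all_nth intro!: cls_eqD)

lemma wf_tapp:
  assumes "distinct xs" "wf_tm R l" "length ss = length xs" "\<And>t. t \<in> set ss \<Longrightarrow> wf_tm R t"
  shows "wf_tm R (tapp xs l ss)"
  unfolding tapp_def using assms by (intro wf_tsubst wf_bind) auto

text \<open>The rules \<open>red_fun\<close> and \<open>red_rule\<close> do not ask for well-formed
  representatives; this is recovered from the classes of the arguments through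
  \<open>cls_wf\<close>.\<close>

lemma reduction_wf:
  "reduction R \<phi> A B \<Longrightarrow> \<exists>s t. wf_tm R s \<and> wf_tm R t \<and> A = cls R s \<and> B = cls R t"
proof (induction rule: reduction.induct)
  case (red_fun f \<phi>s ss ts)
  then have "\<forall>i < arity R f. wf_tm R (ss ! i) \<and> wf_tm R (ts ! i)"
    by (metis cls_wf)
  with red_fun have "wf_tm R (Fn f ss) \<and> wf_tm R (Fn f ts)"
    by (auto simp: in_set_conv_nth)
  then show ?case by blast
next
  case (red_rule \<tau> \<phi>s ss ts)
  then have "\<forall>i < length (rvars R \<tau>). wf_tm R (ss ! i) \<and> wf_tm R (ts ! i)"
    by (metis cls_wf)
  with red_rule have "wf_tm R (tapp (rvars R \<tau>) (lhs R \<tau>) ss)" "wf_tm R (tapp (rvars R \<tau>) (rhs R \<tau>) ts)"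
    by (auto simp: in_set_conv_nth intro!: wf_tapp rule_wf)
  then show ?case by blast
qed blast+

lemma reduction_wf_tm:
  assumes "reduction R \<phi> (cls R s) (cls R t)"
  shows "wf_tm R s" "wf_tm R t"
  using reduction_wf[OF assms] cls_wf by blast+

text \<open>Two derivations may use different representatives for the arguments, but the class of a
  symbol or rule side applied to arguments depends only on their classes. Later proofs rely on this
  whenever the endpoints of two typings have to be identified.\<close>

lemma reduction_det:
  "reduction R \<phi> A B \<Longrightarrow> reduction R \<phi> A' B' \<Longrightarrow> A = A' \<and> B = B'"
proof (induction arbitrary: A' B' rule: reduction.induct)
  case (red_id s)
  from red_id(2) show ?case by (cases rule: reduction.cases) auto
next
  case (red_fun f \<phi>s ss ts)
  note IH = red_fun(5)
  from red_fun(6) show ?case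
  proof (cases rule: reduction.cases)
    case r: (red_fun ss' ts')
    have *: "wf_tm R (ss' ! i) \<and> wf_tm R (ts' ! i) \<and> cls R (ss ! i) = cls R (ss' ! i)
        \<and> cls R (ts ! i) = cls R (ts' ! i)" if "i < arity R f" for i
    proof -
      have "reduction R (\<phi>s ! i) (cls R (ss' ! i)) (cls R (ts' ! i))"
        using r that by simp
      from this reduction_wf_tm[OF this] show ?thesis
        using IH that by blast
    qed
    then have "wf_tm R (Fn f ss')" "wf_tm R (Fn f ts')"
      using r by (auto simp: in_set_conv_nth)
    moreover have "length ss = length ss'" "length ts = length ts'" "length ss' = arity R f"
        "length ts' = arity R f"
      using r red_fun(3,4) by simp_all
    ultimately have "cls R (Fn f ss) = cls R (Fn f ss')" "cls R (Fn f ts) = cls R (Fn f ts')"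
      by (intro cls_Fn_cong; use * in simp)+
    then show ?thesis
      using r(1,2) by simp
  qed
next
  case (red_rule \<tau> \<phi>s ss ts)
  note IH = red_rule(5)
  from red_rule(6) show ?case
  proof (cases rule: reduction.cases)
    case r: (red_rule ss' ts')
    have *: "wf_tm R (ss' ! i) \<and> wf_tm R (ts' ! i) \<and> cls R (ss ! i) = cls R (ss' ! i)
        \<and> cls R (ts ! i) = cls R (ts' ! i)" if "i < length (rvars R \<tau>)" for i
    proof -
      have "reduction R (\<phi>s ! i) (cls R (ss' ! i)) (cls R (ts' ! i))"
        using r that by simp
      from this reduction_wf_tm[OF this] show ?thesis
        using IH that by blast
    qed
    note * = this
    moreover note rule_wf(1-3)[OF red_rule(1)]
    moreover have "length ss = length (rvars R \<tau>)" "length ts = length (rvars R \<tau>)"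
      "length ss' = length (rvars R \<tau>)" "length ts' = length (rvars R \<tau>)"
      using r red_rule(3,4) by simp_all
    ultimately have
      "cls R (tapp (rvars R \<tau>) (lhs R \<tau>) ss) = cls R (tapp (rvars R \<tau>) (lhs R \<tau>) ss')"
      "cls R (tapp (rvars R \<tau>) (rhs R \<tau>) ts) = cls R (tapp (rvars R \<tau>) (rhs R \<tau>) ts')"
      by (intro cls_tapp_cong; use * in simp)+
    then show ?thesis
      using r(1,2) by simp
  qed
next
  case (red_comp \<phi> A B \<psi> C)
  from red_comp(5) show ?case
    by (cases rule: reduction.cases) (use red_comp in blast)+
qed

lemma reduction_compE:
  assumes "reduction R (Comp \<phi> \<psi>) A C"
  obtains B where "reduction R \<phi> A B" "reduction R \<psi> B C"
  using assms by (cases rule: reduction.cases) auto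

lemma reduction_idE:
  assumes "reduction R (Id C) A B"
  shows "A = C" "B = C"
  using assms by (cases rule: reduction.cases; simp)+

lemma reduction_id_src: "reduction R \<phi> A B \<Longrightarrow> reduction R (Id A) A A"
  and reduction_id_tgt: "reduction R \<phi> A B \<Longrightarrow> reduction R (Id B) B B"
  using reduction_wf red_id by blast+

lemma reduction_id_on_tm: "wf_tm R s \<Longrightarrow> reduction R (id_on_tm R s) (cls R s) (cls R s)"
  unfolding id_on_tm_def by (rule red_id)

definition typed :: "('f, 'l) red \<Rightarrow> bool" where
  "typed \<phi> \<longleftrightarrow> (\<exists>A B. reduction R \<phi> A B)"

text \<open>Fixed representatives turn the endpoints of a list of reductions into a list of terms
  via \<open>map\<close>, the form that \<open>red_fun\<close> and \<open>red_rule\<close>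
  expect.\<close>

definition src :: "('f, 'l) red \<Rightarrow> 'f tm" where
  "src \<phi> = (SOME s. \<exists>t. reduction R \<phi> (cls R s) (cls R t))"

definition tgt :: "('f, 'l) red \<Rightarrow> 'f tm" where
  "tgt \<phi> = (SOME t. \<exists>s. reduction R \<phi> (cls R s) (cls R t))"

text \<open>\<open>src\<close> and \<open>tgt\<close> are chosen independently, each with its own
  witness for the other end; uniqueness of endpoints makes the two choices fit together.\<close>

lemma typed_reduction: "typed \<phi> \<Longrightarrow> reduction R \<phi> (cls R (src \<phi>)) (cls R (tgt \<phi>))"
proof -
  assume "typed \<phi>"
  then obtain s t where st: "reduction R \<phi> (cls R s) (cls R t)"
    unfolding typed_def using reduction_wf by blast
  have "\<exists>t. reduction R \<phi> (cls R (src \<phi>)) (cls R t)"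
    unfolding src_def by (rule someI_ex) (use st in blast)
  moreover have "\<exists>s. reduction R \<phi> (cls R s) (cls R (tgt \<phi>))"
    unfolding tgt_def by (rule someI_ex) (use st in blast)
  ultimately show ?thesis using reduction_det by metis
qed

lemma typed_wf: "typed \<phi> \<Longrightarrow> wf_tm R (src \<phi>)" "typed \<phi> \<Longrightarrow> wf_tm R (tgt \<phi>)"
  using typed_reduction reduction_wf_tm by blast+

lemma typed_eq:
  "reduction R \<phi> A B \<Longrightarrow> cls R (src \<phi>) = A \<and> cls R (tgt \<phi>) = B"
  using typed_reduction reduction_det unfolding typed_def by blast

lemma reduction_rsubst:
  assumes "reduction R \<phi> A B" "\<And>x. wf_tm R (\<sigma> x)"
  shows "reduction R (rsubst R \<sigma> \<phi>) (csubst R \<sigma> A) (csubst R \<sigma> B)"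
  using assms(1)
proof (induction rule: reduction.induct)
  case (red_id s)
  then show ?case
    by (auto simp: csubst_cls assms intro!: reduction.red_id wf_tsubst)
next
  case (red_fun f \<phi>s ss ts)
  then have *: "\<forall>i < arity R f. wf_tm R (ss ! i) \<and> wf_tm R (ts ! i)"
    using reduction_wf_tm by blast
  then have "wf_tm R (Fn f ss)" "wf_tm R (Fn f ts)"
    using red_fun by (auto simp: in_set_conv_nth)
  then show ?case
    using red_fun * by (auto simp: csubst_cls assms intro!: reduction.red_fun)
next
  case (red_rule \<tau> \<phi>s ss ts)
  then have *: "\<forall>i < length (rvars R \<tau>). wf_tm R (ss ! i) \<and> wf_tm R (ts ! i)"
    using reduction_wf_tm by blast
  then have "wf_tm R (tapp (rvars R \<tau>) (lhs R \<tau>) ss)" "wf_tm R (tapp (rvars R \<tau>) (rhs R \<tau>) ts)"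
    using red_rule by (auto simp: in_set_conv_nth intro!: wf_tapp rule_wf)
  then show ?case
    using red_rule * by (auto simp: csubst_cls assms tsubst_tapp rule_wf intro!: reduction.red_rule)
qed (auto intro: reduction.red_comp)

lemma reduction_tred:
  assumes "\<And>x. reduction R (\<theta> x) (cls R (\<sigma> x)) (cls R (\<rho> x))" "wf_tm R s"
  shows "reduction R (tred \<theta> s) (cls R (tsubst \<sigma> s)) (cls R (tsubst \<rho> s))"
  using assms(2) by (induction s) (auto intro!: red_fun assms)

lemma reduction_tred_app:
  assumes "distinct xs" "wf_tm R l"
    and "length \<phi>s = length xs" "length ss = length xs" "length ts = length xs"
    and "\<forall>i < length xs. reduction R (\<phi>s ! i) (cls R (ss ! i)) (cls R (ts ! i))"
  shows "reduction R (tred_app R xs l \<phi>s) (cls R (tapp xs l ss)) (cls R (tapp xs l ts))"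
  unfolding tred_app_def tapp_def
proof (rule reduction_tred[OF _ assms(2)])
  fix x
  show "reduction R (bind (\<lambda>x. id_on_tm R (Var x)) xs \<phi>s x) (cls R (bind Var xs ss x)) (cls R (bind Var xs ts x))"
  proof (cases "x \<in> set xs")
    case True
    then show ?thesis
      using assms bind_nth by (metis in_set_conv_nth)
  qed (use assms in \<open>auto simp: bind_notin intro: reduction_id_on_tm\<close>)
qed

lemma reduction_rule_at:
  assumes "\<tau> \<in> labels R" "length ts = length (rvars R \<tau>)" "\<forall>t \<in> set ts. wf_tm R t"
  shows "reduction R (rule_at R \<tau> ts) (cls R (tapp (rvars R \<tau>) (lhs R \<tau>) ts)) (cls R (tapp (rvars R \<tau>) (rhs R \<tau>) ts))"
  using assms unfolding rule_at_def by (auto intro!: red_rule reduction_id_on_tm)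

lemma parallel_reduction:
  assumes "\<exists>A B. reduction R \<alpha> A B \<and> reduction R \<beta> A B"
  shows "reduction R \<alpha> (cls R (src \<alpha>)) (cls R (tgt \<alpha>)) \<and> reduction R \<beta> (cls R (src \<alpha>)) (cls R (tgt \<alpha>))"
proof -
  obtain A B where "reduction R \<alpha> A B" "reduction R \<beta> A B"
    using assms by blast
  with typed_eq[OF this(1)] show ?thesis by simp
qed

text \<open>For \<open>req_ax\<close> this is part of \<open>rewriting_2_theory\<close>; for the
  other clauses both sides are typed. An equality therefore carries the typing of its members, which
  later proofs read off instead of deriving it again.\<close>

lemma req_parallel: "req R \<alpha> \<beta> \<Longrightarrow> \<exists>A B. reduction R \<alpha> A B \<and> reduction R \<beta> A B"
proof (induction rule: req.induct)
  case (req_trans \<alpha> \<beta> \<gamma>)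
  then show ?case using reduction_det by metis
next
  case (req_ax \<alpha> \<beta>)
  then show ?case using theory_R unfolding rewriting_2_theory_def by blast
next
  case (req_fun f \<alpha>s \<beta>s)
  have *: "reduction R (\<alpha>s ! i) (cls R (src (\<alpha>s ! i))) (cls R (tgt (\<alpha>s ! i)))
      \<and> reduction R (\<beta>s ! i) (cls R (src (\<alpha>s ! i))) (cls R (tgt (\<alpha>s ! i)))" if "i < arity R f" for i
    using list_all2_nthD[OF req_fun(3), of i] that req_fun(2) by (intro parallel_reduction) simp
  have "reduction R (FunR f \<gamma>s) (cls R (Fn f (map src \<alpha>s))) (cls R (Fn f (map tgt \<alpha>s)))"
    if "\<gamma>s = \<alpha>s \<or> \<gamma>s = \<beta>s" for \<gamma>s
    using that * req_fun(1,2) list_all2_lengthD[OF req_fun(3)] by (intro red_fun) auto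
  then show ?case by blast
next
  case (req_rule \<tau> \<alpha>s \<beta>s)
  have *: "reduction R (\<alpha>s ! i) (cls R (src (\<alpha>s ! i))) (cls R (tgt (\<alpha>s ! i)))
      \<and> reduction R (\<beta>s ! i) (cls R (src (\<alpha>s ! i))) (cls R (tgt (\<alpha>s ! i)))"
    if "i < length (rvars R \<tau>)" for i
    using list_all2_nthD[OF req_rule(3), of i] that req_rule(2) by (intro parallel_reduction) simp
  have "reduction R (RuleR \<tau> \<gamma>s) (cls R (tapp (rvars R \<tau>) (lhs R \<tau>) (map src \<alpha>s)))
      (cls R (tapp (rvars R \<tau>) (rhs R \<tau>) (map tgt \<alpha>s)))"
    if "\<gamma>s = \<alpha>s \<or> \<gamma>s = \<beta>s" for \<gamma>s
    using that * req_rule(1,2) list_all2_lengthD[OF req_rule(3)] by (intro red_rule) auto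
  then show ?case by blast
next
  case (req_comp \<alpha> \<alpha>' \<beta> \<beta>' A C)
  obtain B where B: "reduction R \<alpha> A B" "reduction R \<beta> B C"
    using req_comp(3) by (rule reduction_compE)
  obtain A1 B1 A2 B2 where "reduction R \<alpha> A1 B1" "reduction R \<alpha>' A1 B1"
      "reduction R \<beta> A2 B2" "reduction R \<beta>' A2 B2"
    using req_comp.IH by blast
  moreover from this have "A1 = A" "B1 = B" "A2 = B" "B2 = C"
    using B reduction_det by blast+
  ultimately show ?case
    using req_comp(3) by (auto intro: red_comp)
next
  case (req_subst \<alpha> \<beta> \<sigma>)
  then show ?case using reduction_rsubst by blast
next
  case (req_unit_left \<alpha> A B)
  then show ?case using red_comp reduction_id_src by blast
next
  case (req_unit_right \<alpha> A B)
  then show ?case using red_comp reduction_id_tgt by blast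
next
  case (req_assoc \<alpha> A B \<beta> C \<gamma> D)
  then show ?case by (blast intro: red_comp)
next
  case (req_functor f \<phi>s \<psi>s)
  define ss where "ss = map src \<phi>s"
  \<comment> \<open>The middle objects are represented by the sources of the second factors; their
    classes are also those of the targets of the first factors.\<close>
  define ts where "ts = map src \<psi>s"
  define us where "us = map tgt \<psi>s"
  have *: "reduction R (\<phi>s ! i) (cls R (ss ! i)) (cls R (ts ! i)) \<and>
      reduction R (\<psi>s ! i) (cls R (ts ! i)) (cls R (us ! i))" if i: "i < arity R f" for i
  proof -
    obtain A B C where r: "reduction R (\<phi>s ! i) A B" "reduction R (\<psi>s ! i) B C"
      using req_functor(4) i by blast
    with typed_eq[OF r(1)] typed_eq[OF r(2)] show ?thesis
      using that req_functor(2,3) by (simp add: ss_def ts_def us_def)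
  qed
  have len: "length ss = arity R f" "length ts = arity R f" "length us = arity R f"
    using req_functor(2,3) by (simp_all add: ss_def ts_def us_def)
  have "reduction R (FunR f \<phi>s) (cls R (Fn f ss)) (cls R (Fn f ts))"
    "reduction R (FunR f \<psi>s) (cls R (Fn f ts)) (cls R (Fn f us))"
    using req_functor(1-3) * len by (auto intro!: red_fun)
  moreover have "reduction R (FunR f (map2 Comp \<phi>s \<psi>s)) (cls R (Fn f ss)) (cls R (Fn f us))"
    using req_functor(1-3) len
    by (intro red_fun) (auto intro: red_comp[OF conjunct1[OF *] conjunct2[OF *]])
  ultimately show ?case by (blast intro: red_comp)
next
  case (req_fun_id f ts)
  then have "reduction R (FunR f (map (id_on_tm R) ts)) (cls R (Fn f ts)) (cls R (Fn f ts))"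
    by (auto intro!: red_fun reduction_id_on_tm)
  then show ?case using reduction_id_on_tm[OF req_fun_id] by blast
next
  case (req_rule_src \<tau> \<phi>s ss ts)
  have "wf_tm R (ts ! i)" if "i < length (rvars R \<tau>)" for i
    using req_rule_src(5) that by (blast dest: reduction_wf_tm)
  then have "\<forall>t\<in>set ts. wf_tm R t"
    using req_rule_src(4) by (auto simp: in_set_conv_nth)
  note reduction_rule_at[OF req_rule_src(1,4) this]
  moreover note reduction_tred_app[OF rule_wf(1,2)[OF req_rule_src(1)] req_rule_src(2-5)]
  ultimately show ?case
    using red_rule[OF req_rule_src] by (blast intro: red_comp)
next
  case (req_rule_tgt \<tau> \<phi>s ss ts)
  have "wf_tm R (ss ! i)" if "i < length (rvars R \<tau>)" for i
    using req_rule_tgt(5) that by (blast dest: reduction_wf_tm)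
  then have "\<forall>t\<in>set ss. wf_tm R t"
    using req_rule_tgt(3) by (auto simp: in_set_conv_nth)
  note reduction_rule_at[OF req_rule_tgt(1,3) this]
  moreover note reduction_tred_app[OF rule_wf(1,3)[OF req_rule_tgt(1)] req_rule_tgt(2-5)]
  ultimately show ?case
    using red_rule[OF req_rule_tgt] by (blast intro: red_comp)
next
  case (req_exchange \<phi> s t \<theta> \<sigma> \<rho>)
  have wf: "wf_tm R s" "wf_tm R t"
    using reduction_wf_tm[OF req_exchange(1)] .
  have wf': "wf_tm R (\<sigma> x)" "wf_tm R (\<rho> x)" for x
    using reduction_wf_tm[OF req_exchange(2)] .
  have "reduction R (rsubst R \<mu> \<phi>) (cls R (tsubst \<mu> s)) (cls R (tsubst \<mu> t))"
    if "\<mu> = \<sigma> \<or> \<mu> = \<rho>" for \<mu>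
    using reduction_rsubst[OF req_exchange(1), of \<mu>] that wf wf' by (auto simp: csubst_cls)
  moreover have "reduction R (tred \<theta> u) (cls R (tsubst \<sigma> u)) (cls R (tsubst \<rho> u))" if "wf_tm R u" for u
    using reduction_tred[OF req_exchange(2) that] .
  ultimately show ?case
    using wf by (blast intro: red_comp)
qed blast+

section \<open>Calculating with composites up to equality\<close>

lemma req_reduction: "req R \<alpha> \<beta> \<Longrightarrow> reduction R \<alpha> A B \<Longrightarrow> reduction R \<beta> A B"
  using req_parallel reduction_det by blast

text \<open>The intermediate object of a composite comes from any equation about it, so composites
  supplied by functoriality or exchange need no separate typing.\<close>

lemma req_compE:
  assumes "req R (Comp \<phi> \<psi>) \<gamma>"
  obtains A B C where "reduction R \<phi> A B" "reduction R \<psi> B C"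
proof -
  obtain A C where "reduction R (Comp \<phi> \<psi>) A C"
    using req_parallel[OF assms] by blast
  then show thesis
    by (rule reduction_compE) (rule that)
qed

lemma comp_cong:
  assumes "req R \<alpha> \<alpha>'" "req R \<beta> \<beta>'" "reduction R \<alpha> A B" "reduction R \<beta> B C"
  shows "req R (Comp \<alpha> \<beta>) (Comp \<alpha>' \<beta>')"
  by (rule req_comp[OF assms(1,2) red_comp[OF assms(3,4)]])

lemma comp_cong_left:
  assumes "req R \<alpha> \<alpha>'" "reduction R \<alpha> A B" "reduction R \<beta> B C"
  shows "req R (Comp \<alpha> \<beta>) (Comp \<alpha>' \<beta>)"
  by (rule comp_cong[OF assms(1) req_refl[OF assms(3)] assms(2,3)])

lemma comp_cong_right:
  assumes "req R \<beta> \<beta>'" "reduction R \<alpha> A B" "reduction R \<beta> B C"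
  shows "req R (Comp \<alpha> \<beta>) (Comp \<alpha> \<beta>')"
  by (rule comp_cong[OF req_refl[OF assms(2)] assms(1) assms(2,3)])

lemma id_on_tm_idem: "wf_tm R t \<Longrightarrow> req R (Comp (id_on_tm R t) (id_on_tm R t)) (id_on_tm R t)"
  unfolding id_on_tm_def by (rule req_unit_left[OF red_id])

definition composable :: "('f, 'l) red \<Rightarrow> ('f, 'l) red \<Rightarrow> bool" where
  "composable \<phi> \<psi> \<longleftrightarrow> (\<exists>A B C. reduction R \<phi> A B \<and> reduction R \<psi> B C)"

lemma composableI: "reduction R \<phi> A B \<Longrightarrow> reduction R \<psi> B C \<Longrightarrow> composable \<phi> \<psi>"
  unfolding composable_def by blast

lemma composable_ids:
  "\<forall>t \<in> set us. wf_tm R t \<Longrightarrow> list_all2 composable (map (id_on_tm R) us) (map (id_on_tm R) us)"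
  by (auto simp: list_all2_map1 list_all2_map2 list_all2_same
      intro: composableI[OF reduction_id_on_tm reduction_id_on_tm])

text \<open>Functoriality and congruence in one step: with \<open>\<gamma>s\<close> the simplified
  components, a factorization of a symbol application is verified place by place.\<close>

lemma req_FunR_comp:
  assumes "f \<in> syms R" "length \<phi>s = arity R f"
    and "list_all2 composable \<phi>s \<psi>s"
    and "list_all2 (req R) (map2 Comp \<phi>s \<psi>s) \<gamma>s"
  shows "req R (Comp (FunR f \<phi>s) (FunR f \<psi>s)) (FunR f \<gamma>s)"
proof (rule req_trans)
  show "req R (Comp (FunR f \<phi>s) (FunR f \<psi>s)) (FunR f (map2 Comp \<phi>s \<psi>s))"
    using assms(1-3) by (intro req_functor) (auto simp: list_all2_conv_all_nth composable_def)
  show "req R (FunR f (map2 Comp \<phi>s \<psi>s)) (FunR f \<gamma>s)"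
    using assms by (intro req_fun) (auto simp: list_all2_conv_all_nth)
qed

end

section \<open>One-place contexts and decomposition into singular reductions\<close>

definition hole :: "('f, 'l) rw2 \<Rightarrow> 'f \<Rightarrow> 'f tm list \<Rightarrow> 'f tm list \<Rightarrow> ('f, 'l) red \<Rightarrow> ('f, 'l) red" where
  "hole R f us vs \<phi> = FunR f (map (id_on_tm R) us @ \<phi> # map (id_on_tm R) vs)"

definition hole_wf :: "('f, 'l) rw2 \<Rightarrow> 'f \<Rightarrow> 'f tm list \<Rightarrow> 'f tm list \<Rightarrow> bool" where
  "hole_wf R f us vs \<longleftrightarrow> f \<in> syms R \<and> length us + 1 + length vs = arity R f \<and>
     (\<forall>t \<in> set us \<union> set vs. wf_tm R t)"

lemma map2_same: "map2 h (map f xs) (map g xs) = map (\<lambda>x. h (f x) (g x)) xs"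
  by (induction xs) auto

text \<open>A list of singular reductions encoded as an expression: nested to the right and closed
  by an identity as the empty list, so that induction peels off the first singular
  reduction.\<close>

inductive chain :: "('f, 'l) rw2 \<Rightarrow> ('f, 'l) red \<Rightarrow> 'f tm set \<Rightarrow> 'f tm set \<Rightarrow> bool" for R where
  chain_id: "wf_tm R s \<Longrightarrow> chain R (Id (cls R s)) (cls R s) (cls R s)"
| chain_comp: "singular R \<rho> \<Longrightarrow> reduction R \<rho> A B \<Longrightarrow> chain R \<phi> B C \<Longrightarrow> chain R (Comp \<rho> \<phi>) A C"

lemma chain_reduction: "chain R \<chi> A B \<Longrightarrow> reduction R \<chi> A B"
  by (induction rule: chain.induct) (auto intro: red_id red_comp)

definition decomposable :: "('f, 'l) rw2 \<Rightarrow> ('f, 'l) red \<Rightarrow> bool" where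
  "decomposable R \<phi> \<longleftrightarrow> (\<exists>\<chi> A B. chain R \<chi> A B \<and> req R \<phi> \<chi>)"

context rewriting_2
begin

lemma reduction_hole:
  assumes "hole_wf R f us vs" "reduction R \<phi> (cls R s) (cls R t)"
  shows "reduction R (hole R f us vs \<phi>) (cls R (Fn f (us @ s # vs))) (cls R (Fn f (us @ t # vs)))"
  using assms unfolding hole_def hole_wf_def
  by (intro red_fun) (auto simp: nth_append nth_Cons split: nat.split intro!: reduction_id_on_tm)

lemma reduction_hole_ex:
  assumes "hole_wf R f us vs" "reduction R \<phi> A B"
  obtains A' B' where "reduction R (hole R f us vs \<phi>) A' B'"
  using reduction_hole assms reduction_wf by blast

lemma hole_comp_reductions:
  assumes "hole_wf R f us vs" "reduction R \<phi> A B" "reduction R \<psi> B C"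
  obtains A' B' C' where "reduction R (hole R f us vs \<phi>) A' B'" "reduction R (hole R f us vs \<psi>) B' C'"
proof -
  obtain s t where st: "A = cls R s" "B = cls R t"
    using reduction_wf[OF assms(2)] by blast
  obtain u where "C = cls R u"
    using reduction_wf[OF assms(3)] by blast
  with st assms that show thesis
    using reduction_hole by blast
qed

lemma hole_cong:
  assumes "hole_wf R f us vs" "req R \<phi> \<psi>"
  shows "req R (hole R f us vs \<phi>) (hole R f us vs \<psi>)"
  using assms unfolding hole_def hole_wf_def
  by (intro req_fun) (auto intro!: list_all2_appendI req_refl[OF reduction_id_on_tm]
      simp: list_all2_map1 list_all2_map2 list_all2_same)

lemma hole_id:
  assumes "hole_wf R f us vs" "wf_tm R s"
  shows "req R (hole R f us vs (Id (cls R s))) (Id (cls R (Fn f (us @ s # vs))))"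
  using req_fun_id[of R f "us @ s # vs"] assms unfolding hole_def hole_wf_def id_on_tm_def by auto

lemma hole_comp:
  assumes "hole_wf R f us vs" "reduction R \<phi> A B" "reduction R \<psi> B C"
  shows "req R (Comp (hole R f us vs \<phi>) (hole R f us vs \<psi>)) (hole R f us vs (Comp \<phi> \<psi>))"
  unfolding hole_def
proof (rule req_FunR_comp)
  show "list_all2 composable
      (map (id_on_tm R) us @ \<phi> # map (id_on_tm R) vs) (map (id_on_tm R) us @ \<psi> # map (id_on_tm R) vs)"
    using assms unfolding hole_wf_def
    by (intro list_all2_appendI list.rel_intros(2) composable_ids composableI) auto
  show "list_all2 (req R)
      (map2 Comp (map (id_on_tm R) us @ \<phi> # map (id_on_tm R) vs) (map (id_on_tm R) us @ \<psi> # map (id_on_tm R) vs))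
      (map (id_on_tm R) us @ Comp \<phi> \<psi> # map (id_on_tm R) vs)"
    using assms unfolding hole_wf_def
    by (auto simp: map2_same list_all2_map1 list_all2_map2 list_all2_same
        intro!: list_all2_appendI id_on_tm_idem req_refl red_comp)
qed (use assms in \<open>auto simp: hole_wf_def\<close>)

lemma singular_reduction: "singular R \<rho> \<Longrightarrow> \<exists>A B. reduction R \<rho> A B"
proof (induction rule: singular.induct)
  case (sing_rule \<tau> ts)
  then show ?case using reduction_rule_at by blast
next
  case (sing_fun f us vs \<rho>)
  then have "hole_wf R f us vs"
    by (simp add: hole_wf_def)
  with sing_fun.IH show ?case
    using reduction_hole_ex unfolding hole_def by metis
qed

lemma singular_hole: "hole_wf R f us vs \<Longrightarrow> singular R \<rho> \<Longrightarrow> singular R (hole R f us vs \<rho>)"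
  unfolding hole_def hole_wf_def by (intro sing_fun) auto

text \<open>As for appending lists: the closing identity of the first chain is absorbed, and
  associativity moves the second chain to the right.\<close>

lemma chain_append:
  "chain R \<chi> A B \<Longrightarrow> chain R \<chi>' B C \<Longrightarrow> \<exists>\<chi>''. chain R \<chi>'' A C \<and> req R (Comp \<chi> \<chi>') \<chi>''"
proof (induction rule: chain.induct)
  case (chain_id s)
  then show ?case
    using req_unit_left chain_reduction by blast
next
  case (chain_comp \<rho> A B \<phi> D)
  then obtain \<chi>'' where \<chi>'': "chain R \<chi>'' B C" "req R (Comp \<phi> \<chi>') \<chi>''"
    by blast
  note red = chain_reduction[OF chain_comp(3)] chain_reduction[OF chain_comp(5)]
  have "req R (Comp (Comp \<rho> \<phi>) \<chi>') (Comp \<rho> (Comp \<phi> \<chi>'))"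
    by (rule req_assoc[OF chain_comp(2) red])
  moreover have "req R (Comp \<rho> (Comp \<phi> \<chi>')) (Comp \<rho> \<chi>'')"
    by (rule comp_cong_right[OF \<chi>''(2) chain_comp(2) red_comp[OF red]])
  ultimately show ?case
    using req_trans chain.chain_comp[OF chain_comp(1,2) \<chi>''(1)] by blast
qed

lemma decomposable_typed: "decomposable R \<phi> \<Longrightarrow> typed \<phi>"
  unfolding decomposable_def typed_def using req_parallel by blast

lemma decomposable_req: "req R \<phi> \<psi> \<Longrightarrow> decomposable R \<psi> \<Longrightarrow> decomposable R \<phi>"
  unfolding decomposable_def using req_trans by blast

lemma decomposable_id_on_tm: "wf_tm R s \<Longrightarrow> decomposable R (id_on_tm R s)"
  unfolding decomposable_def id_on_tm_def using chain_id req_refl red_id by blast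

lemma decomposable_comp:
  assumes "decomposable R \<phi>" "decomposable R \<psi>" "reduction R \<phi> A B" "reduction R \<psi> B C"
  shows "decomposable R (Comp \<phi> \<psi>)"
proof -
  obtain \<chi> A1 B1 \<chi>' A2 B2 where \<chi>: "chain R \<chi> A1 B1" "req R \<phi> \<chi>" "chain R \<chi>' A2 B2" "req R \<psi> \<chi>'"
    using assms unfolding decomposable_def by blast
  have "B1 = B" "A2 = B"
    using req_reduction[OF \<chi>(2) assms(3)] req_reduction[OF \<chi>(4) assms(4)]
      chain_reduction[OF \<chi>(1)] chain_reduction[OF \<chi>(3)] reduction_det by blast+
  with chain_append \<chi> obtain \<chi>'' where "chain R \<chi>'' A1 B2" "req R (Comp \<chi> \<chi>') \<chi>''"
    by blast
  then show ?thesis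
    using comp_cong[OF \<chi>(2,4) assms(3,4)] req_trans unfolding decomposable_def by blast
qed

lemma decomposable_singular:
  assumes "singular R \<rho>" "reduction R \<rho> A B"
  shows "decomposable R \<rho>"
proof -
  obtain t where t: "wf_tm R t" "B = cls R t"
    using reduction_wf[OF assms(2)] by blast
  have "chain R (Comp \<rho> (Id B)) A B"
    using chain_comp[OF assms] chain_id[OF t(1)] t(2) by blast
  then show ?thesis
    unfolding decomposable_def using req_sym[OF req_unit_right[OF assms(2)]] by blast
qed

text \<open>A hole is functorial up to \<open>req\<close> and sends singular reductions to singular
  ones, so it can be pushed through a chain link by link.\<close>

lemma decomposable_hole:
  assumes "hole_wf R f us vs" "decomposable R \<phi>"
  shows "decomposable R (hole R f us vs \<phi>)"
proof -
  have "decomposable R (hole R f us vs \<chi>)" if "chain R \<chi> A B" for \<chi> A B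
    using that
  proof (induction rule: chain.induct)
    case (chain_id s)
    then have "wf_tm R (Fn f (us @ s # vs))"
      using assms(1) by (auto simp: hole_wf_def)
    from decomposable_req[OF hole_id[OF assms(1) chain_id] decomposable_id_on_tm[OF this, unfolded id_on_tm_def]]
    show ?case .
  next
    case (chain_comp \<rho> A B \<phi> C)
    note red = chain_comp(2) chain_reduction[OF chain_comp(3)]
    obtain A' B' C' where r: "reduction R (hole R f us vs \<rho>) A' B'" "reduction R (hole R f us vs \<phi>) B' C'"
      using hole_comp_reductions[OF assms(1) red] .
    have "decomposable R (hole R f us vs \<rho>)"
      using decomposable_singular[OF singular_hole[OF assms(1) chain_comp(1)] r(1)] .
    from decomposable_req[OF req_sym[OF hole_comp[OF assms(1) red]] decomposable_comp[OF this chain_comp.IH r]]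
    show ?case .
  qed
  then show ?thesis
    using assms(2) hole_cong[OF assms(1)] decomposable_req unfolding decomposable_def by blast
qed

text \<open>Arguments are reduced from left to right, by the factorization F(1, \<phi>, \<phi>s) =
  F(1, \<phi>, 1) \<cdot> F(1, 1, \<phi>s). The prefix \<open>us\<close> collects the targets of the
  arguments already treated; it has to be general for the induction.\<close>

lemma decomposable_FunR_append:
  assumes "f \<in> syms R" "length us + length \<phi>s = arity R f" "\<forall>t \<in> set us. wf_tm R t"
    and "\<forall>\<phi> \<in> set \<phi>s. decomposable R \<phi>"
  shows "decomposable R (FunR f (map (id_on_tm R) us @ \<phi>s))"
  using assms(2-)
proof (induction \<phi>s arbitrary: us)
  case Nil
  then have "wf_tm R (Fn f us)"
    using assms(1) by simp
  from decomposable_req[OF req_fun_id[OF this] decomposable_id_on_tm[OF this]] show ?case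
    by simp
next
  case (Cons \<phi> \<phi>s)
  define ss where "ss = map src \<phi>s"
  define t where "t = tgt \<phi>"
  have typed: "typed \<phi>" "\<And>\<psi>. \<psi> \<in> set \<phi>s \<Longrightarrow> typed \<psi>"
    using Cons.prems by (auto intro: decomposable_typed)
  have \<phi>: "reduction R \<phi> (cls R (src \<phi>)) (cls R t)" and t: "wf_tm R t"
    using typed_reduction typed_wf typed t_def by auto
  have hw: "hole_wf R f us ss"
    using Cons.prems assms(1) typed typed_wf by (auto simp: hole_wf_def ss_def)
  have id: "reduction R (id_on_tm R u) (cls R u) (cls R u)" if "wf_tm R u" for u
    using that by (rule reduction_id_on_tm)
  have comp: "list_all2 composable
      (map (id_on_tm R) us @ \<phi> # map (id_on_tm R) ss) (map (id_on_tm R) us @ id_on_tm R t # \<phi>s)"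
  proof (intro list_all2_appendI list.rel_intros(2) composable_ids composableI[OF \<phi> id[OF t]])
    \<comment> \<open>To the right of the hole the first factor waits at the sources of the
      arguments not yet reduced.\<close>
    show "list_all2 composable (map (id_on_tm R) ss) \<phi>s"
      using composableI[OF id[OF typed_wf(1)] typed_reduction] typed(2)
      by (auto simp: list_all2_conv_all_nth ss_def)
  qed (use Cons.prems(2) in auto)
  have req: "list_all2 (req R)
      (map2 Comp (map (id_on_tm R) us @ \<phi> # map (id_on_tm R) ss) (map (id_on_tm R) us @ id_on_tm R t # \<phi>s))
      (map (id_on_tm R) us @ \<phi> # \<phi>s)"
  proof -
    have "list_all2 (req R) (map2 Comp (map (id_on_tm R) ss) \<phi>s) \<phi>s"
      using req_unit_left[OF typed_reduction[OF typed(2)]]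
      by (auto simp: list_all2_conv_all_nth ss_def id_on_tm_def)
    moreover have "req R (Comp \<phi> (id_on_tm R t)) \<phi>"
      unfolding id_on_tm_def by (rule req_unit_right[OF \<phi>])
    ultimately show ?thesis
      using Cons.prems(2) by (auto simp: map2_same list_all2_map1 list_all2_map2 list_all2_same
        intro!: list_all2_appendI id_on_tm_idem)
  qed
  have eq: "req R (Comp (hole R f us ss \<phi>) (FunR f (map (id_on_tm R) us @ id_on_tm R t # \<phi>s)))
      (FunR f (map (id_on_tm R) us @ \<phi> # \<phi>s))"
    unfolding hole_def using Cons.prems(1)
    by (intro req_FunR_comp assms(1) comp req) (simp add: ss_def)
  obtain A B C where "reduction R (hole R f us ss \<phi>) A B"
      "reduction R (FunR f (map (id_on_tm R) us @ id_on_tm R t # \<phi>s)) B C"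
    using eq by (rule req_compE)
  moreover have "decomposable R (hole R f us ss \<phi>)"
    using decomposable_hole[OF hw] Cons.prems(3) by simp
  moreover have "decomposable R (FunR f (map (id_on_tm R) us @ id_on_tm R t # \<phi>s))"
    using Cons.IH[of "us @ [t]"] Cons.prems t by simp
  ultimately show ?case
    using decomposable_req[OF req_sym[OF eq]] decomposable_comp by blast
qed

lemma decomposable_FunR:
  assumes "f \<in> syms R" "length \<phi>s = arity R f" "\<forall>\<phi> \<in> set \<phi>s. decomposable R \<phi>"
  shows "decomposable R (FunR f \<phi>s)"
  using decomposable_FunR_append[of f "[]" \<phi>s] assms by simp

lemma decomposable_tred:
  "wf_tm R s \<Longrightarrow> (\<And>x. decomposable R (\<theta> x)) \<Longrightarrow> decomposable R (tred \<theta> s)"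
  by (induction s) (auto intro!: decomposable_FunR)

text \<open>Only a rule applied to reductions is not covered by the previous lemmas; the exchange
  law separates the work on its arguments from the rule itself.\<close>

lemma decomposable_reduction: "reduction R \<phi> A B \<Longrightarrow> decomposable R \<phi>"
proof (induction rule: reduction.induct)
  case (red_id s)
  then show ?case
    using decomposable_id_on_tm unfolding id_on_tm_def by blast
next
  case (red_fun f \<phi>s ss ts)
  then show ?case
    by (intro decomposable_FunR) (auto simp: in_set_conv_nth)
next
  case (red_rule \<tau> \<phi>s ss ts)
  have wf: "wf_tm R (ts ! i)" if "i < length (rvars R \<tau>)" for i
    using red_rule(5) that by (blast dest: reduction_wf_tm)
  \<comment> \<open>The arguments are reduced first, inside the left-hand side; what remains is the
    rule at their targets, and that is singular.\<close>
  have eq: "req R (RuleR \<tau> \<phi>s) (Comp (tred_app R (rvars R \<tau>) (lhs R \<tau>) \<phi>s) (rule_at R \<tau> ts))"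
    using red_rule by (intro req_rule_src) auto
  obtain A B C where red: "reduction R (tred_app R (rvars R \<tau>) (lhs R \<tau>) \<phi>s) A B"
      "reduction R (rule_at R \<tau> ts) B C"
    using req_sym[OF eq] by (rule req_compE)
  have "singular R (rule_at R \<tau> ts)"
    using red_rule(1,4) wf by (intro sing_rule) (auto simp: in_set_conv_nth)
  moreover have "decomposable R (tred_app R (rvars R \<tau>) (lhs R \<tau>) \<phi>s)"
    unfolding tred_app_def
  proof (rule decomposable_tred[OF rule_wf(2)[OF red_rule(1)]])
    fix x
    show "decomposable R (bind (\<lambda>x. id_on_tm R (Var x)) (rvars R \<tau>) \<phi>s x)"
      using rule_wf(1)[OF red_rule(1)] red_rule(2)
      by (cases rule: bind_cases[where x = x and d = "\<lambda>x. id_on_tm R (Var x)"])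
        (use red_rule(5) in \<open>auto intro: decomposable_id_on_tm\<close>)
  qed
  ultimately show ?case
    using decomposable_req[OF eq decomposable_comp] decomposable_singular red by blast
next
  case (red_comp \<phi> A B \<psi> C)
  then show ?case using decomposable_comp by blast
qed

end

section \<open>Newman's lemma for commuting diagrams\<close>

locale convergent_rewriting_2 = rewriting_2 +
  assumes terminating_R: "terminating R"
    and confluent_R: "locally_commuting_confluent R"
begin

text \<open>
  Singular reductions equal to an identity are not steps: termination allows infinitely many of them.
\<close>

definition step :: "('a tm set \<times> 'a tm set) set" where
  "step = {(B, A). \<exists>\<rho>. singular R \<rho> \<and> reduction R \<rho> A B \<and> \<not> req R \<rho> (Id A)}"

text \<open>Singular reductions may still start at a normal object, provided each of them equals an
  identity.\<close>

definition normal :: "'a tm set \<Rightarrow> bool" where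
  "normal A \<longleftrightarrow> (\<forall>B. (B, A) \<notin> step)"

lemma wf_step: "wf step"
  unfolding wf_iff_no_infinite_down_chain
proof
  assume "\<exists>f. \<forall>i. (f (Suc i), f i) \<in> step"
  then obtain A where "\<forall>i. (A (Suc i), A i) \<in> step" ..
  then obtain \<phi> where \<phi>: "\<forall>i. singular R (\<phi> i) \<and> reduction R (\<phi> i) (A i) (A (Suc i)) \<and> \<not> req R (\<phi> i) (Id (A i))"
    unfolding step_def by simp metis
  then have "finite {i. \<not> req R (\<phi> i) (Id (A i))}"
    using terminating_R unfolding terminating_def by blast
  with \<phi> show False by simp
qed

text \<open>A leading singular reduction that equals an identity leaves the object unchanged and is
  absorbed by the unit law; what is left either vanishes or begins with a genuine step.\<close>

lemma chain_step:
  "chain R \<chi> A C \<Longrightarrow> A = C \<and> req R \<chi> (Id A) \<or>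
    (\<exists>\<rho> B \<phi>. singular R \<rho> \<and> reduction R \<rho> A B \<and> (B, A) \<in> step \<and> reduction R \<phi> B C \<and> req R \<chi> (Comp \<rho> \<phi>))"
proof (induction rule: chain.induct)
  case (chain_id s)
  then show ?case by (auto intro: req_refl red_id)
next
  case (chain_comp \<rho> A B \<phi> C)
  note red = chain_comp(2) chain_reduction[OF chain_comp(3)]
  show ?case
  proof (cases "req R \<rho> (Id A)")
    case True
    then have "A = B"
      using req_reduction[OF True red(1)] reduction_idE by blast
    moreover have "req R (Comp \<rho> \<phi>) \<phi>"
      using req_trans[OF comp_cong_left[OF True red]] req_unit_left red(2) \<open>A = B\<close> by blast
    ultimately show ?thesis
      using chain_comp.IH req_trans by blast
  next
    case False
    then have "(B, A) \<in> step"
      unfolding step_def using chain_comp by blast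
    then show ?thesis
      using chain_comp(1) red req_refl[OF red_comp[OF red]] by blast
  qed
qed

text \<open>The case distinction for Newman's induction: it exposes a first step of a reduction
  whose expression need not be a composite.\<close>

lemma reduction_step:
  assumes "reduction R \<alpha> A C"
  obtains "A = C" "req R \<alpha> (Id A)"
  | \<rho> B \<phi> where "singular R \<rho>" "reduction R \<rho> A B" "(B, A) \<in> step" "reduction R \<phi> B C" "req R \<alpha> (Comp \<rho> \<phi>)"
proof -
  obtain \<chi> A' C' where \<chi>: "chain R \<chi> A' C'" "req R \<alpha> \<chi>"
    using decomposable_reduction[OF assms] unfolding decomposable_def by blast
  have "A' = A" "C' = C"
    using req_reduction[OF \<chi>(2) assms] chain_reduction[OF \<chi>(1)] reduction_det by blast+
  then show thesis
    using chain_step[OF \<chi>(1)] req_trans[OF \<chi>(2)] that by blast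
qed

text \<open>The premise expresses that \<open>A\<close> is the class of a well-formed term, in the
  form delivered by the typing lemmas.\<close>

lemma normal_form_exists: "reduction R (Id A) A A \<Longrightarrow> \<exists>\<nu> N. reduction R \<nu> A N \<and> normal N"
proof (induction A rule: wf_induct_rule[OF wf_step])
  case (1 A)
  show ?case
  proof (cases "normal A")
    case False
    then obtain B \<rho> where "(B, A) \<in> step" "reduction R \<rho> A B"
      unfolding normal_def step_def by blast
    with 1 show ?thesis
      using reduction_id_tgt red_comp by blast
  qed (use 1 in blast)
qed

text \<open>Three commuting regions are pasted: the local join of the two first steps, and on either
  side of it a comparison by the induction hypothesis at the object reached by that step.\<close>

lemma normal_form_unique:
  "reduction R \<phi>\<^sub>1 A N\<^sub>1 \<Longrightarrow> normal N\<^sub>1 \<Longrightarrow> reduction R \<phi>\<^sub>2 A N\<^sub>2 \<Longrightarrow> normal N\<^sub>2 \<Longrightarrow>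
    N\<^sub>1 = N\<^sub>2 \<and> req R \<phi>\<^sub>1 \<phi>\<^sub>2"
proof (induction A arbitrary: \<phi>\<^sub>1 N\<^sub>1 \<phi>\<^sub>2 N\<^sub>2 rule: wf_induct_rule[OF wf_step])
  case (1 A)
  note IH = 1(1) and \<phi> = 1(2,4) and normal = 1(3,5)
  show ?case
  proof (cases rule: reduction_step[OF \<phi>(1)])
    case 1
    note N1 = this
    show ?thesis
    proof (cases rule: reduction_step[OF \<phi>(2)])
      case 1
      then show ?thesis
        using N1 req_trans req_sym by blast
    qed (use N1 normal normal_def in blast)
  next
    case r1: (2 \<rho>\<^sub>1 B\<^sub>1 \<phi>\<^sub>1')
    show ?thesis
    proof (cases rule: reduction_step[OF \<phi>(2)])
      case 1
      then show ?thesis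
        using r1(3) normal normal_def by blast
    next
      case r2: (2 \<rho>\<^sub>2 B\<^sub>2 \<phi>\<^sub>2')
      obtain S U\<^sub>1 U\<^sub>2 T \<psi>\<^sub>1 \<psi>\<^sub>2 where "reduction R \<rho>\<^sub>1 S U\<^sub>1" "reduction R \<rho>\<^sub>2 S U\<^sub>2"
        and U: "reduction R \<psi>\<^sub>1 U\<^sub>1 T" "reduction R \<psi>\<^sub>2 U\<^sub>2 T"
        and comm: "req R (Comp \<rho>\<^sub>1 \<psi>\<^sub>1) (Comp \<rho>\<^sub>2 \<psi>\<^sub>2)"
        using confluent_R r1(1,2) r2(1,2)
        unfolding locally_commuting_confluent_def commuting_joinable_def by meson
      \<comment> \<open>The join is stated with endpoints of its own, which determinacy identifies
        with the targets of the two given steps.\<close>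
      then have "U\<^sub>1 = B\<^sub>1" "U\<^sub>2 = B\<^sub>2"
        using r1(2) r2(2) reduction_det by blast+
      with U have \<psi>: "reduction R \<psi>\<^sub>1 B\<^sub>1 T" "reduction R \<psi>\<^sub>2 B\<^sub>2 T"
        by simp_all
      \<comment> \<open>The join object need not be normal. Continued to a normal form, each leg of
        the join competes with the remaining reduction from the same object, so the induction
        hypothesis applies to both.\<close>
      obtain \<nu> N where \<nu>: "reduction R \<nu> T N" "normal N"
        using normal_form_exists[OF reduction_id_tgt[OF \<psi>(1)]] by blast
      have I1: "N\<^sub>1 = N \<and> req R \<phi>\<^sub>1' (Comp \<psi>\<^sub>1 \<nu>)"
        using IH[OF r1(3,4) normal(1) red_comp[OF \<psi>(1) \<nu>(1)] \<nu>(2)] .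
      have I2: "N = N\<^sub>2 \<and> req R (Comp \<psi>\<^sub>2 \<nu>) \<phi>\<^sub>2'"
        using IH[OF r2(3) red_comp[OF \<psi>(2) \<nu>(1)] \<nu>(2) r2(4) normal(2)] .
      note r1(5)
      also have "req R (Comp \<rho>\<^sub>1 \<phi>\<^sub>1') (Comp \<rho>\<^sub>1 (Comp \<psi>\<^sub>1 \<nu>))"
        using comp_cong_right[OF conjunct2[OF I1] r1(2,4)] .
      also have "req R (Comp \<rho>\<^sub>1 (Comp \<psi>\<^sub>1 \<nu>)) (Comp (Comp \<rho>\<^sub>1 \<psi>\<^sub>1) \<nu>)"
        using req_sym[OF req_assoc[OF r1(2) \<psi>(1) \<nu>(1)]] .
      also have "req R (Comp (Comp \<rho>\<^sub>1 \<psi>\<^sub>1) \<nu>) (Comp (Comp \<rho>\<^sub>2 \<psi>\<^sub>2) \<nu>)"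
        using comp_cong_left[OF comm red_comp[OF r1(2) \<psi>(1)] \<nu>(1)] .
      also have "req R (Comp (Comp \<rho>\<^sub>2 \<psi>\<^sub>2) \<nu>) (Comp \<rho>\<^sub>2 (Comp \<psi>\<^sub>2 \<nu>))"
        using req_assoc[OF r2(2) \<psi>(2) \<nu>(1)] .
      also have "req R (Comp \<rho>\<^sub>2 (Comp \<psi>\<^sub>2 \<nu>)) (Comp \<rho>\<^sub>2 \<phi>\<^sub>2')"
        using comp_cong_right[OF conjunct2[OF I2] r2(2) red_comp[OF \<psi>(2) \<nu>(1)]] .
      also have "req R (Comp \<rho>\<^sub>2 \<phi>\<^sub>2') \<phi>\<^sub>2"
        using req_sym[OF r2(5)] .
      finally show ?thesis
        using I1 I2 by simp
    qed
  qed
qed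

end

section \<open>Comparison of the theory with its positive subtheory\<close>

lemma positive_subtheory_simps [simp]:
  "syms (positive_subtheory R orn) = syms R" "arity (positive_subtheory R orn) = arity R"
  "rvars (positive_subtheory R orn) = rvars R" "lhs (positive_subtheory R orn) = lhs R"
  "rhs (positive_subtheory R orn) = rhs R" "term_eqs (positive_subtheory R orn) = term_eqs R"
  by (simp_all add: positive_subtheory_def)

lemma labels_positive_subtheory:
  "labels (positive_subtheory R orn) = labels R - negative_rules R orn"
  by (simp add: positive_subtheory_def)

lemma wf_tm_positive_subtheory [simp]: "wf_tm (positive_subtheory R orn) t = wf_tm R t"
  by (induction t) auto

text \<open>Stated for any two theories with the same terms and term equations, so that it serves in
  both directions when the classes are shown to coincide.\<close>

lemma teq_subtheory:
  assumes "teq S s t" "syms S = syms R" "arity S = arity R" "term_eqs S = term_eqs R"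
    and "\<And>t. wf_tm S t = wf_tm R t"
  shows "teq R s t"
  using assms(1)
proof (induction rule: teq.induct)
  case (teq_refl t)
  then show ?case using assms by (auto intro: teq.teq_refl)
next
  case (teq_sym s t)
  then show ?case by (blast intro: teq.teq_sym)
next
  case (teq_trans s t u)
  then show ?case by (blast intro: teq.teq_trans)
next
  case (teq_cong f ss ts)
  then show ?case using assms by (auto intro!: teq.teq_cong elim: list_all2_mono)
next
  case (teq_ax s t \<sigma>)
  then show ?case using assms by (auto intro!: teq.teq_ax)
qed

lemma cls_positive_subtheory [simp]: "cls (positive_subtheory R orn) = cls R"
proof -
  have "teq (positive_subtheory R orn) s t = teq R s t" for s t
    by (auto elim!: teq_subtheory)
  then show ?thesis
    by (simp add: cls_def fun_eq_iff)
qed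

lemma id_on_tm_positive_subtheory [simp]: "id_on_tm (positive_subtheory R orn) = id_on_tm R"
  by (simp add: id_on_tm_def fun_eq_iff)

lemma rule_at_positive_subtheory [simp]: "rule_at (positive_subtheory R orn) = rule_at R"
  by (simp add: rule_at_def fun_eq_iff)

lemma tred_app_positive_subtheory [simp]: "tred_app (positive_subtheory R orn) = tred_app R"
  by (simp add: tred_app_def fun_eq_iff)

lemma csubst_positive_subtheory [simp]: "csubst (positive_subtheory R orn) = csubst R"
  by (simp add: csubst_def fun_eq_iff)

lemma rsubst_positive_subtheory [simp]: "rsubst (positive_subtheory R orn) \<sigma> \<phi> = rsubst R \<sigma> \<phi>"
  by (induction \<phi>) auto

lemma reduction_positive_subtheory_imp:
  assumes "reduction (positive_subtheory R orn) \<phi> A B"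
  shows "reduction R \<phi> A B"
  using assms
proof (induction rule: reduction.induct)
  case (red_id s)
  then show ?case using reduction.red_id[of R] by simp
next
  case (red_fun f \<phi>s ss ts)
  then show ?case using reduction.red_fun[of f R \<phi>s ss ts] by simp
next
  case (red_rule \<tau> \<phi>s ss ts)
  then show ?case using reduction.red_rule[of \<tau> R \<phi>s ss ts] by (simp add: labels_positive_subtheory)
next
  case (red_comp \<phi> A B \<psi> C)
  then show ?case by (blast intro: reduction.red_comp)
qed

text \<open>Typing uses only the rules whose labels occur in the expression. This is applied to the
  sides of the retained equations and to identities, which carry no labels.\<close>

lemma reduction_positive_subtheory:
  assumes "reduction R \<phi> A B" "rule_labels \<phi> \<inter> negative_rules R orn = {}"
  shows "reduction (positive_subtheory R orn) \<phi> A B"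
  using assms
proof (induction rule: reduction.induct)
  case (red_id s)
  then show ?case using reduction.red_id[of "positive_subtheory R orn"] by simp
next
  case (red_fun f \<phi>s ss ts)
  then have "rule_labels (\<phi>s ! i) \<inter> negative_rules R orn = {}" if "i < arity R f" for i
    using that nth_mem[of i \<phi>s] by fastforce
  with red_fun show ?case
    using reduction.red_fun[of f "positive_subtheory R orn" \<phi>s ss ts] by simp
next
  case (red_rule \<tau> \<phi>s ss ts)
  then have "rule_labels (\<phi>s ! i) \<inter> negative_rules R orn = {}" if "i < length (rvars R \<tau>)" for i
    using that nth_mem[of i \<phi>s] by fastforce
  with red_rule show ?case
    using reduction.red_rule[of \<tau> "positive_subtheory R orn" \<phi>s ss ts] by (simp add: labels_positive_subtheory)
next
  case (red_comp \<phi> A B \<psi> C)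
  then show ?case by (auto intro: reduction.red_comp)
qed

text \<open>A derivation over the positive subtheory uses rules and equations that are also in
  \<open>R\<close>. Through this lemma the uniqueness of normal forms becomes an equality in
  \<open>R\<close>.\<close>

lemma req_positive_subtheory_imp:
  assumes "req (positive_subtheory R orn) \<alpha> \<beta>"
  shows "req R \<alpha> \<beta>"
  using assms
proof (induction rule: req.induct)
  case (req_refl \<alpha> A B)
  then show ?case by (blast intro: req.req_refl reduction_positive_subtheory_imp)
next
  case (req_sym \<alpha> \<beta>)
  then show ?case by (blast intro: req.req_sym)
next
  case (req_trans \<alpha> \<beta> \<gamma>)
  then show ?case by (blast intro: req.req_trans)
next
  case (req_ax \<alpha> \<beta>)
  then show ?case by (intro req.req_ax) (simp add: positive_subtheory_def)
next
  case (req_fun f \<alpha>s \<beta>s)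
  then show ?case by (intro req.req_fun) (auto elim: list_all2_mono)
next
  case (req_rule \<tau> \<alpha>s \<beta>s)
  then show ?case by (intro req.req_rule) (auto simp: labels_positive_subtheory elim: list_all2_mono)
next
  case (req_comp \<alpha> \<alpha>' \<beta> \<beta>' A C)
  then show ?case by (blast intro: req.req_comp reduction_positive_subtheory_imp)
next
  case (req_subst \<alpha> \<beta> \<sigma>)
  then show ?case by (auto intro: req.req_subst)
next
  case (req_unit_left \<alpha> A B)
  then show ?case by (blast intro: req.req_unit_left reduction_positive_subtheory_imp)
next
  case (req_unit_right \<alpha> A B)
  then show ?case by (blast intro: req.req_unit_right reduction_positive_subtheory_imp)
next
  case (req_assoc \<alpha> A B \<beta> C \<gamma> D)
  then show ?case by (blast intro: req.req_assoc reduction_positive_subtheory_imp)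
next
  case (req_functor f \<phi>s \<psi>s)
  then show ?case by (intro req.req_functor) (simp_all, blast intro: reduction_positive_subtheory_imp)
next
  case (req_fun_id f ts)
  then show ?case using req.req_fun_id[of R f ts] by simp
next
  case (req_rule_src \<tau> \<phi>s ss ts)
  then have "\<forall>i < length (rvars R \<tau>). reduction R (\<phi>s ! i) (cls R (ss ! i)) (cls R (ts ! i))"
    by (auto intro: reduction_positive_subtheory_imp)
  with req_rule_src show ?case
    using req.req_rule_src[of \<tau> R \<phi>s ss ts] by (simp add: labels_positive_subtheory)
next
  case (req_rule_tgt \<tau> \<phi>s ss ts)
  then have "\<forall>i < length (rvars R \<tau>). reduction R (\<phi>s ! i) (cls R (ss ! i)) (cls R (ts ! i))"
    by (auto intro: reduction_positive_subtheory_imp)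
  with req_rule_tgt show ?case
    using req.req_rule_tgt[of \<tau> R \<phi>s ss ts] by (simp add: labels_positive_subtheory)
next
  case (req_exchange \<phi> s t \<theta> \<sigma> \<rho>)
  then have "reduction R \<phi> (cls R s) (cls R t)" "\<And>x. reduction R (\<theta> x) (cls R (\<sigma> x)) (cls R (\<rho> x))"
    by (auto intro: reduction_positive_subtheory_imp)
  from req.req_exchange[OF this] show ?case
    by simp
qed

section \<open>Inverses of singular reductions and naturality of normal forms\<close>

locale oriented_rewriting_2 = rewriting_2 R for R :: "('f, 'l) rw2" +
  fixes orn :: "'l \<Rightarrow> int"
  assumes invertible_R: "invertible_theory R"
    and orientation_R: "orientation R orn"
    and terminating_P: "terminating (positive_subtheory R orn)"
    and confluent_P: "locally_commuting_confluent (positive_subtheory R orn)"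
begin

abbreviation P :: "('f, 'l) rw2" where
  "P \<equiv> positive_subtheory R orn"

sublocale P: convergent_rewriting_2 P
proof
  have "\<exists>A B. reduction P \<alpha> A B \<and> reduction P \<beta> A B" if "(\<alpha>, \<beta>) \<in> red_eqs P" for \<alpha> \<beta>
  proof -
    have "(\<alpha>, \<beta>) \<in> red_eqs R" and *: "rule_labels \<alpha> \<inter> negative_rules R orn = {}"
      "rule_labels \<beta> \<inter> negative_rules R orn = {}"
      using that by (auto simp: positive_subtheory_def)
    then obtain A B where "reduction R \<alpha> A B" "reduction R \<beta> A B"
      using theory_R unfolding rewriting_2_theory_def by blast
    with * show ?thesis
      using reduction_positive_subtheory by blast
  qed
  then show "rewriting_2_theory P"
    using theory_R unfolding rewriting_2_theory_def by (auto simp: labels_positive_subtheory)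
qed (fact terminating_P confluent_P)+

lemma rsubst_rule_at:
  assumes "\<And>x. wf_tm R (\<sigma> x)" "\<forall>t \<in> set ts. wf_tm R t"
  shows "rsubst R \<sigma> (rule_at R \<tau> ts) = rule_at R \<tau> (map (tsubst \<sigma>) ts)"
  using assms by (simp add: rule_at_def id_on_tm_def csubst_cls)

text \<open>Invertibility is given as an equation at renamed variables only; an arbitrary instance
  follows by a substitution that undoes the renaming.\<close>

lemma singular_rule_inverse:
  assumes "\<tau> \<in> labels R" "length ts = length (rvars R \<tau>)" "\<forall>t \<in> set ts. wf_tm R t"
  shows "\<exists>A B \<rho>'. reduction R (rule_at R \<tau> ts) A B \<and> reduction R \<rho>' B A \<and>
    req R (Comp (rule_at R \<tau> ts) \<rho>') (Id A) \<and> (singular P (rule_at R \<tau> ts) \<or> singular P \<rho>')"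
proof -
  obtain \<psi> where inv: "inverse_rules R \<tau> \<psi>"
    using invertible_R assms(1) unfolding invertible_theory_def invertible_rule_def by blast
  then obtain \<sigma> :: "nat \<Rightarrow> nat" where \<psi>: "\<psi> \<in> labels R" and "inj \<sigma>" and
    eq: "has_red_eq R (Comp (rule_at R \<tau> (map (\<lambda>x. Var (\<sigma> x)) (rvars R \<tau>)))
          (rule_at R \<psi> (map (\<lambda>x. Var (\<sigma> x)) (rvars R \<psi>))))
      (id_on_tm R (tsubst (\<lambda>x. Var (\<sigma> x)) (lhs R \<tau>)))"
    unfolding inverse_rules_def Let_def by blast
  \<comment> \<open>\<open>\<theta>\<close> sends the renamed variables of \<open>\<tau>\<close> to
    the entries of \<open>ts\<close>; this is consistent because \<open>\<sigma>\<close> is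
    injective and the variables of a rule are distinct.\<close>
  define \<theta> where "\<theta> = bind Var (map \<sigma> (rvars R \<tau>)) ts"
  \<comment> \<open>The inverse rule lists its variables in its own way, so its arguments are read
    off from the same substitution.\<close>
  define us where "us = map (\<lambda>x. \<theta> (\<sigma> x)) (rvars R \<psi>)"
  have distinct: "distinct (map \<sigma> (rvars R \<tau>))"
    using rule_wf(1)[OF assms(1)] \<open>inj \<sigma>\<close> by (simp add: distinct_map inj_on_def)
  have wf: "wf_tm R (\<theta> x)" for x
    unfolding \<theta>_def using distinct assms(2,3) by (intro wf_bind) auto
  have ts: "map (\<lambda>x. \<theta> (\<sigma> x)) (rvars R \<tau>) = ts"
    using bind_nth[OF distinct, of ts] assms(2) by (auto simp: \<theta>_def intro!: nth_equalityI)
  have "req R (Comp (rule_at R \<tau> (map (\<lambda>x. Var (\<sigma> x)) (rvars R \<tau>)))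
          (rule_at R \<psi> (map (\<lambda>x. Var (\<sigma> x)) (rvars R \<psi>))))
      (id_on_tm R (tsubst (\<lambda>x. Var (\<sigma> x)) (lhs R \<tau>)))"
    using eq unfolding has_red_eq_def by (auto intro: req_ax req_sym)
  from req_subst[where \<sigma> = \<theta>, OF this wf]
  obtain C where C: "req R (Comp (rule_at R \<tau> ts) (rule_at R \<psi> us)) (Id C)"
    using wf by (auto simp: rsubst_rule_at us_def ts comp_def id_on_tm_def)
  obtain A B D where AB: "reduction R (rule_at R \<tau> ts) A B" "reduction R (rule_at R \<psi> us) B D"
    using C by (rule req_compE)
  \<comment> \<open>The substituted identity is known only as some \<open>Id C\<close>; typing shows
    that it sits on the source and that the inverse leads back there.\<close>
  have "A = C" "D = C"
    using req_reduction[OF C red_comp[OF AB]] reduction_idE by blast+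
  moreover have "singular P (rule_at R \<tau> ts) \<or> singular P (rule_at R \<psi> us)"
  proof -
    have "orn \<tau> = 1 \<or> orn \<psi> = 1"
      using orientation_R inv unfolding orientation_def by (metis insert_iff singletonD)
    then have "\<tau> \<in> labels P \<or> \<psi> \<in> labels P"
      using assms(1) \<psi> by (auto simp: labels_positive_subtheory negative_rules_def)
    then show ?thesis
      using sing_rule[of \<tau> P ts] sing_rule[of \<psi> P us] assms(2,3) wf by (auto simp: us_def)
  qed
  ultimately show ?thesis
    using AB C by blast
qed

text \<open>Holes respect composites and identities, hence also inverses. Positivity is inherited
  because a hole is the same expression over \<open>P\<close> and over \<open>R\<close>.\<close>

lemma singular_inverse:
  "singular R \<rho> \<Longrightarrow> \<exists>A B \<rho>'. reduction R \<rho> A B \<and> reduction R \<rho>' B A \<and>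
    req R (Comp \<rho> \<rho>') (Id A) \<and> (singular P \<rho> \<or> singular P \<rho>')"
proof (induction rule: singular.induct)
  case (sing_rule \<tau> ts)
  then show ?case by (rule singular_rule_inverse)
next
  case (sing_fun f us vs \<rho>)
  then have hw: "hole_wf R f us vs" and hwP: "hole_wf P f us vs"
    by (simp_all add: hole_wf_def)
  from sing_fun.IH obtain A B \<rho>' where AB: "reduction R \<rho> A B" "reduction R \<rho>' B A"
    and eq: "req R (Comp \<rho> \<rho>') (Id A)" and pos: "singular P \<rho> \<or> singular P \<rho>'"
    by blast
  obtain s t where st: "wf_tm R s" "A = cls R s" "B = cls R t"
    using reduction_wf[OF AB(1)] by blast
  have "reduction R (hole R f us vs \<rho>) (cls R (Fn f (us @ s # vs))) (cls R (Fn f (us @ t # vs)))"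
    "reduction R (hole R f us vs \<rho>') (cls R (Fn f (us @ t # vs))) (cls R (Fn f (us @ s # vs)))"
    using reduction_hole[OF hw] AB st by auto
  moreover have "req R (Comp (hole R f us vs \<rho>) (hole R f us vs \<rho>')) (Id (cls R (Fn f (us @ s # vs))))"
    using req_trans[OF hole_comp[OF hw AB] req_trans[OF hole_cong[OF hw eq]]] hole_id[OF hw st(1)] st by simp
  moreover have "hole P f us vs \<phi> = hole R f us vs \<phi>" for \<phi>
    by (simp add: hole_def)
  then have "singular P (hole R f us vs \<rho>) \<or> singular P (hole R f us vs \<rho>')"
    using pos P.singular_hole[OF hwP] by metis
  ultimately show ?case
    unfolding hole_def by blast
qed

text \<open>The inverses of the links of a chain are composed in reverse order, and the resulting
  composite collapses from the middle outwards.\<close>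

lemma right_inverse:
  assumes "reduction R \<phi> A B"
  obtains \<phi>' where "reduction R \<phi>' B A" "req R (Comp \<phi> \<phi>') (Id A)"
proof -
  have chain: "\<exists>\<chi>'. reduction R \<chi>' D C \<and> req R (Comp \<chi> \<chi>') (Id C)" if "chain R \<chi> C D" for \<chi> C D
    using that
  proof (induction rule: chain.induct)
    case (chain_id s)
    then show ?case
      using red_id req_unit_left by blast
  next
    case (chain_comp \<rho> A B \<phi> C)
    note \<phi> = chain_reduction[OF chain_comp(3)]
    obtain \<phi>' where \<phi>': "reduction R \<phi>' C B" "req R (Comp \<phi> \<phi>') (Id B)"
      using chain_comp.IH by blast
    obtain A' B' \<rho>' where "reduction R \<rho> A' B'" "reduction R \<rho>' B' A'" "req R (Comp \<rho> \<rho>') (Id A')"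
      using singular_inverse[OF chain_comp(1)] by blast
    moreover from this have "A' = A" "B' = B"
      using chain_comp(2) reduction_det by blast+
    ultimately have \<rho>': "reduction R \<rho>' B A" "req R (Comp \<rho> \<rho>') (Id A)"
      by simp_all
    note \<rho> = chain_comp(2)
    have "req R (Comp (Comp \<rho> \<phi>) (Comp \<phi>' \<rho>')) (Comp \<rho> (Comp \<phi> (Comp \<phi>' \<rho>')))"
      by (rule req_assoc[OF \<rho> \<phi> red_comp[OF \<phi>'(1) \<rho>'(1)]])
    also have "req R (Comp \<rho> (Comp \<phi> (Comp \<phi>' \<rho>'))) (Comp \<rho> (Comp (Comp \<phi> \<phi>') \<rho>'))"
      by (rule comp_cong_right[OF req_sym[OF req_assoc[OF \<phi> \<phi>'(1) \<rho>'(1)]] \<rho> red_comp[OF \<phi> red_comp[OF \<phi>'(1) \<rho>'(1)]]])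
    also have "req R (Comp \<rho> (Comp (Comp \<phi> \<phi>') \<rho>')) (Comp \<rho> \<rho>')"
      by (rule comp_cong_right[OF req_trans[OF comp_cong_left[OF \<phi>'(2) red_comp[OF \<phi> \<phi>'(1)] \<rho>'(1)] req_unit_left[OF \<rho>'(1)]]
        \<rho> red_comp[OF red_comp[OF \<phi> \<phi>'(1)] \<rho>'(1)]])
    also note \<rho>'(2)
    finally show ?case
      using red_comp[OF \<phi>'(1) \<rho>'(1)] by blast
  qed
  obtain \<chi> C D where \<chi>: "chain R \<chi> C D" "req R \<phi> \<chi>"
    using decomposable_reduction[OF assms] unfolding decomposable_def by blast
  have CD: "C = A" "D = B"
    using req_reduction[OF \<chi>(2) assms] chain_reduction[OF \<chi>(1)] reduction_det by blast+
  with chain[OF \<chi>(1)] obtain \<phi>' where "reduction R \<phi>' B A" "req R (Comp \<chi> \<phi>') (Id A)"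
    by blast
  then show thesis
    using that req_trans[OF comp_cong_left[OF \<chi>(2) assms]] by blast
qed

text \<open>The chain is followed one singular reduction at a time. If that reduction is positive,
  the triangle it forms with the two normalizations commutes by uniqueness at its source; if its
  inverse is positive, by uniqueness at its target, followed by cancellation in
  \<open>R\<close>.\<close>

lemma normal_form_natural:
  "chain R \<chi> A B \<Longrightarrow> reduction P \<nu> A M \<Longrightarrow> P.normal M \<Longrightarrow> reduction P \<mu> B N \<Longrightarrow> P.normal N \<Longrightarrow>
    M = N \<and> req R \<nu> (Comp \<chi> \<mu>)"
proof (induction arbitrary: \<nu> M rule: chain.induct)
  case (chain_id s)
  then have "M = N" "req R \<nu> \<mu>"
    using P.normal_form_unique req_positive_subtheory_imp by blast+
  moreover have "req R \<mu> (Comp (Id (cls R s)) \<mu>)"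
    by (rule req_sym[OF req_unit_left[OF reduction_positive_subtheory_imp[OF chain_id(4)]]])
  ultimately show ?case
    using req_trans by blast
next
  case (chain_comp \<rho> A B \<phi> C)
  note \<rho> = chain_comp(2) and \<phi> = chain_reduction[OF chain_comp(3)]
  note toR = reduction_positive_subtheory_imp
  obtain t where "wf_tm R t" "B = cls R t"
    using reduction_wf[OF \<rho>] by blast
  then have "reduction P (Id B) B B"
    using red_id[of P t] by simp
  \<comment> \<open>An auxiliary normalization of the intermediate object, needed to split the claim
    into a triangle for \<open>\<rho>\<close> and the induction hypothesis for the rest.\<close>
  then obtain \<xi> L where \<xi>: "reduction P \<xi> B L" "P.normal L"
    using P.normal_form_exists by blast
  have IH: "L = N" "req R \<xi> (Comp \<phi> \<mu>)"
    using chain_comp.IH[OF \<xi> chain_comp.prems(3,4)] by blast+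
  obtain A' B' \<rho>' where "reduction R \<rho> A' B'" "reduction R \<rho>' B' A'" "req R (Comp \<rho> \<rho>') (Id A')"
    and pos: "singular P \<rho> \<or> singular P \<rho>'"
    using singular_inverse[OF chain_comp(1)] by blast
  moreover from this have "A' = A" "B' = B"
    using \<rho> reduction_det by blast+
  ultimately have \<rho>': "reduction R \<rho>' B A" "req R (Comp \<rho> \<rho>') (Id A)"
    by simp_all
  have "M = L \<and> req R \<nu> (Comp \<rho> \<xi>)"
    using pos
  proof
    assume "singular P \<rho>"
    then have "reduction P \<rho> A B"
      using P.singular_reduction[of \<rho>] \<rho> toR reduction_det by blast
    then show ?thesis
      using P.normal_form_unique[OF chain_comp.prems(1,2) red_comp[OF _ \<xi>(1)] \<xi>(2)]
        req_positive_subtheory_imp by blast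
  next
    assume "singular P \<rho>'"
    then have "reduction P \<rho>' B A"
      using P.singular_reduction[of \<rho>'] \<rho>'(1) toR reduction_det by blast
    \<comment> \<open>Both \<open>\<rho>'\<close> followed by \<open>\<nu>\<close> and
      \<open>\<xi>\<close> are positive and lead from \<open>B\<close> to a normal object. Prefixing
      \<open>\<rho>\<close> then cancels \<open>\<rho>'\<close> and leaves
      \<open>\<nu>\<close>.\<close>
    then have eq: "M = L" "req R (Comp \<rho>' \<nu>) \<xi>"
      using P.normal_form_unique[OF red_comp[OF _ chain_comp.prems(1)] chain_comp.prems(2) \<xi>]
        req_positive_subtheory_imp by blast+
    note \<nu> = toR[OF chain_comp.prems(1)]
    have "req R \<nu> (Comp (Id A) \<nu>)"
      by (rule req_sym[OF req_unit_left[OF \<nu>]])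
    also have "req R (Comp (Id A) \<nu>) (Comp (Comp \<rho> \<rho>') \<nu>)"
      by (rule req_sym[OF comp_cong_left[OF \<rho>'(2) red_comp[OF \<rho> \<rho>'(1)] \<nu>]])
    also note req_assoc[OF \<rho> \<rho>'(1) \<nu>]
    also note comp_cong_right[OF eq(2) \<rho> red_comp[OF \<rho>'(1) \<nu>]]
    finally show ?thesis
      using eq(1) by blast
  qed
  moreover have "req R (Comp \<rho> \<xi>) (Comp (Comp \<rho> \<phi>) \<mu>)"
    using req_trans[OF comp_cong_right[OF IH(2) \<rho> toR[OF \<xi>(1)]] req_sym[OF req_assoc[OF \<rho> \<phi> toR[OF chain_comp.prems(3)]]]] .
  ultimately show ?case
    using IH(1) req_trans by blast
qed

lemma parallel_equal:
  assumes "reduction R \<alpha> A B" "reduction R \<beta> A B"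
  shows "req R \<alpha> \<beta>"
proof -
  have id: "reduction P (Id C) C C" if "reduction R (Id C) C C" for C
    using reduction_positive_subtheory[OF that] by simp
  obtain \<nu> M where \<nu>: "reduction P \<nu> A M" "P.normal M"
    using P.normal_form_exists[OF id[OF reduction_id_src[OF assms(1)]]] by blast
  obtain \<mu> N where \<mu>: "reduction P \<mu> B N" "P.normal N"
    using P.normal_form_exists[OF id[OF reduction_id_tgt[OF assms(1)]]] by blast
  note \<mu>R = reduction_positive_subtheory_imp[OF \<mu>(1)]
  \<comment> \<open>\<open>\<mu>\<close> is positive, but its inverse may use negative rules and is
    therefore taken in \<open>R\<close>.\<close>
  obtain \<mu>' where \<mu>': "reduction R \<mu>' N B" "req R (Comp \<mu> \<mu>') (Id B)"
    using right_inverse[OF \<mu>R] .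
  have "req R \<gamma> (Comp \<nu> \<mu>')" if \<gamma>: "reduction R \<gamma> A B" for \<gamma>
  proof -
    obtain \<chi> C D where \<chi>: "chain R \<chi> C D" "req R \<gamma> \<chi>"
      using decomposable_reduction[OF \<gamma>] unfolding decomposable_def by blast
    have "C = A" "D = B"
      using req_reduction[OF \<chi>(2) \<gamma>] chain_reduction[OF \<chi>(1)] reduction_det by blast+
    with \<chi>(1) have "req R \<nu> (Comp \<chi> \<mu>)"
      using normal_form_natural \<nu> \<mu> by blast
    then have "req R (Comp \<gamma> \<mu>) \<nu>"
      using comp_cong_left[OF \<chi>(2) \<gamma> \<mu>R] req_trans req_sym by blast
    note nat = comp_cong_left[OF this red_comp[OF \<gamma> \<mu>R] \<mu>'(1)]
    have "req R \<gamma> (Comp \<gamma> (Id B))"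
      by (rule req_sym[OF req_unit_right[OF \<gamma>]])
    also have "req R (Comp \<gamma> (Id B)) (Comp \<gamma> (Comp \<mu> \<mu>'))"
      by (rule req_sym[OF comp_cong_right[OF \<mu>'(2) \<gamma> red_comp[OF \<mu>R \<mu>'(1)]]])
    also note req_sym[OF req_assoc[OF \<gamma> \<mu>R \<mu>'(1)]]
    also note nat
    finally show ?thesis .
  qed
  from req_trans[OF this[OF assms(1)] req_sym[OF this[OF assms(2)]]] show ?thesis .
qed

end

theorem theorem4p3p3:
  fixes R :: "('f, 'l) rw2"
  assumes "rewriting_2_theory R"
    and "finitely_presented R"
    and "invertible_theory R"
    and "\<exists>orn. orientation R orn \<and>
           terminating (positive_subtheory R orn) \<and>
           locally_commuting_confluent (positive_subtheory R orn)"
  shows "mac_lane_coherent R"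
proof -
  obtain orn where "orientation R orn" "terminating (positive_subtheory R orn)"
      "locally_commuting_confluent (positive_subtheory R orn)"
    using assms(4) by blast
  with assms(1,3) interpret oriented_rewriting_2 R orn
    by unfold_locales
  show ?thesis
    unfolding mac_lane_coherent_def using parallel_equal by blast
qed

end
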